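(* Let $m\ge 1$ be odd, $d\ge 1$, let $R=\sum_{i=0}^d a_ix^{2^i}\in\mathbf{F}_{2^m}[x]$ with $a_d\neq 0$, and set $f(x)=xR(x)$. Let $\widetilde R=\sum_{i=0}^d\left(a_i^{2^d}x^{2^{d+i}}+a_i^{2^{d-i}}x^{2^{d-i}}\right)$, and let $\mathbf{F}_{2^{mN}}$ be the splitting field of $\widetilde R$ over $\mathbf{F}_{2^m}$. For any even $n\ge2$, the invariant $\varepsilon_n(f)$ satisfies: (i) if $\varepsilon_N(f)=-1$, then $\varepsilon_n(f)=\varepsilon_{\gcd(n,N)}(f)$; (ii) if $\varepsilon_N(f)=1$, then: $\varepsilon_n(f)=0$ when $1\le v_2(n)\le v_2(N)-1$; $\varepsilon_n(f)=\varepsilon_{\gcd(n,N)}(f)$ when $v_2(n)=v_2(N)$; and $\varepsilon_n(f)=-\varepsilon_{\gcd(n,N)}(f)$ when $v_2(n)\ge v_2(N)+1$; (iii) if $\varepsilon_N(f)=0$, then: (iiia) when $\varepsilon_{2N}(f)=-1$, we have $\varepsilon_n(f)=\varepsilon_{\gcd(n,2N)}(f)$; (iiib) when $\varepsilon_{2N}(f)=1$, we have: $\varepsilon_n(f)=0$ if $1\le v_2(n)\le v_2(N)$; $\varepsilon_n(f)=\varepsilon_{\gcd(n,2N)}(f)$ if $v_2(n)=v_2(N)+1$; and $\varepsilon_n(f)=-\varepsilon_{\gcd(n,2N)}(f)$ if $v_2(n)\ge v_2(N)+2$.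
   Context: For a quadratic form $q$ on a $k$-dimensional $\mathbf{F}_2$-vector space $V$, with polarisation $b(x,y)=q(x+y)+q(x)+q(y)$ whose radical has dimension $c$ (set $r=k-c$), the invariant $\varepsilon(q)\in\{0,1,-1\}$ is defined as follows: $\varepsilon(q)=0$ if $q$ is not identically zero on the radical of $b$ (equivalently $q$ is isometric to $x_1x_2+\cdots+x_{r-1}x_r+x_{r+1}^2$); $\varepsilon(q)=1$ if $q$ is isometric to $x_1x_2+\cdots+x_{r-1}x_r$; $\varepsilon(q)=-1$ if $q$ is isometric to $x_1^2+x_1x_2+x_2^2+x_3x_4+\cdots+x_{r-1}x_r$. One has $\sum_{x\in V}(-1)^{q(x)}=\varepsilon(q)2^{(k+c)/2}$. For $n\ge1$, $q_n=\mathrm{Tr}_{\mathbf{F}_{2^{mn}}/\mathbf{F}_2}\circ f$ is a quadratic form on the $\mathbf{F}_2$-vector space $\mathbf{F}_{2^{mn}}$, and $\varepsilon_n(f):=\varepsilon(q_n)$. $v_2$ denotes the $2$-adic valuation. (When $m$ is odd, $N$ is even.) *)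

theory Defs
  imports
    "HOL-Algebra.Algebraic_Closure_Type"
    "HOL-Algebra.Generated_Fields"
    "HOL-Library.Z2"
    "HOL-Library.Function_Algebras"
begin

text \<open>
  \<^typ>\<open>bit\<close> is the field with two elements. Its only possible action on an additive group of
  exponent 2 turns that group into a vector space over it. Vector spaces over \<^typ>\<open>bit\<close> are
  rendered as subspaces of such a group, so that the library notions of subspace and dimension apply.
\<close>

definition f2_scale :: "bit \<Rightarrow> 'v::ab_group_add \<Rightarrow> 'v" where
  "f2_scale c x = (if c = 1 then x else 0)"

lemma vector_space_f2_scale:
  assumes "\<And>x::'v::ab_group_add. x + x = 0"
  shows "vector_space (f2_scale :: bit \<Rightarrow> 'v \<Rightarrow> 'v)"
proof
  fix a b :: bit and x y :: 'v
  show "f2_scale a (x + y) = f2_scale a x + f2_scale a y"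
    by (simp add: f2_scale_def)
  show "f2_scale (a + b) x = f2_scale a x + f2_scale b x"
    by (cases a; cases b) (simp_all add: f2_scale_def assms)
  show "f2_scale a (f2_scale b x) = f2_scale (a * b) x"
    by (cases a; cases b) (simp_all add: f2_scale_def)
  show "f2_scale 1 x = x"
    by (simp add: f2_scale_def)
qed

definition f2_dim :: "'v::ab_group_add set \<Rightarrow> nat" where
  "f2_dim V = vector_space.dim f2_scale V"

definition polarisation :: "('v::ab_group_add \<Rightarrow> bit) \<Rightarrow> 'v \<Rightarrow> 'v \<Rightarrow> bit" where
  "polarisation q x y = q (x + y) + q x + q y"

definition qf_radical :: "'v::ab_group_add set \<Rightarrow> ('v \<Rightarrow> bit) \<Rightarrow> 'v set" where
  "qf_radical V q = {x \<in> V. \<forall>y\<in>V. polarisation q x y = 0}"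

definition isometric ::
  "'v::ab_group_add set \<Rightarrow> ('v \<Rightarrow> bit) \<Rightarrow> 'w::ab_group_add set \<Rightarrow> ('w \<Rightarrow> bit) \<Rightarrow> bool" where
  "isometric V q W q' \<longleftrightarrow>
     (\<exists>\<phi>. bij_betw \<phi> V W \<and>
          (\<forall>x\<in>V. \<forall>y\<in>V. \<phi> (x + y) = \<phi> x + \<phi> y) \<and>
          (\<forall>c. \<forall>x\<in>V. \<phi> (f2_scale c x) = f2_scale c (\<phi> x)) \<and>
          (\<forall>x\<in>V. q' (\<phi> x) = q x))"

text \<open>Coordinate space of dimension \<open>k\<close>, with coordinates \<open>x 1, \<dots>, x k\<close>.\<close>

definition f2_space :: "nat \<Rightarrow> (nat \<Rightarrow> bit) set" where
  "f2_space k = {x. \<forall>i. i \<notin> {1..k} \<longrightarrow> x i = 0}"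

text \<open>
  The two model forms in \<open>x 1, \<dots>, x r\<close>, with \<open>r\<close> even (and \<open>r \<ge> 2\<close> for the second):
  \<open>x\<^sub>1x\<^sub>2 + \<dots> + x\<^sub>r\<^sub>-\<^sub>1x\<^sub>r\<close> and
  \<open>x\<^sub>1\<^sup>2 + x\<^sub>1x\<^sub>2 + x\<^sub>2\<^sup>2 + x\<^sub>3x\<^sub>4 + \<dots> + x\<^sub>r\<^sub>-\<^sub>1x\<^sub>r\<close>.
\<close>

definition plus_form :: "nat \<Rightarrow> (nat \<Rightarrow> bit) \<Rightarrow> bit" where
  "plus_form r x = (\<Sum>j=1..r div 2. x (2 * j - 1) * x (2 * j))"

definition minus_form :: "nat \<Rightarrow> (nat \<Rightarrow> bit) \<Rightarrow> bit" where
  "minus_form r x =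
     x 1 ^ 2 + x 1 * x 2 + x 2 ^ 2 + (\<Sum>j=2..r div 2. x (2 * j - 1) * x (2 * j))"

text \<open>
  By the classification of quadratic forms, the last branch is never reached when \<open>q\<close> is a
  quadratic form on a finite-dimensional \<open>V\<close>.
\<close>

definition qf_eps :: "'v::ab_group_add set \<Rightarrow> ('v \<Rightarrow> bit) \<Rightarrow> int" where
  "qf_eps V q =
     (let k = f2_dim V; r = k - f2_dim (qf_radical V q) in
      if \<exists>x\<in>qf_radical V q. q x \<noteq> 0 then 0
      else if isometric V q (f2_space k) (plus_form r) then 1
      else if r \<ge> 2 \<and> isometric V q (f2_space k) (minus_form r) then -1
      else undefined)"

text \<open>
  Finite fields of characteristic 2 live inside an ambient algebraically closed field of
  characteristic 2, which contains exactly one subfield with \<open>2 ^ k\<close> elements for each \<open>k \<ge> 1\<close>.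
\<close>

definition gf2 :: "nat \<Rightarrow> 'a::field set" where
  "gf2 k = {x. x ^ (2 ^ k) = x}"

text \<open>
  The absolute trace of \<open>gf2 k\<close>, as the sum of the conjugates. On \<open>gf2 k\<close> this sum is \<open>0\<close> or \<open>1\<close>
  in \<^typ>\<open>'a\<close>, and is read as an element of \<^typ>\<open>bit\<close>.
\<close>

definition abs_trace :: "nat \<Rightarrow> 'a::field \<Rightarrow> bit" where
  "abs_trace k x = (if (\<Sum>j<k. x ^ (2 ^ j)) = 0 then 0 else 1)"

definition eps_ext :: "nat \<Rightarrow> 'a::field poly \<Rightarrow> nat \<Rightarrow> int" where
  "eps_ext m f n = qf_eps (gf2 (m * n)) (\<lambda>x. abs_trace (m * n) (poly f x))"

text \<open>
  The splitting field of \<open>p\<close> over \<open>K\<close> inside the ambient field. As that field is algebraically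
  closed, \<open>p\<close> splits over any subfield containing all its roots.
\<close>

definition splitting_field :: "'a::alg_closed_field set \<Rightarrow> 'a poly \<Rightarrow> 'a set" where
  "splitting_field K p = generate_field ring_of_type_algebra (K \<union> {x. poly p x = 0})"

end

theory Submission
  imports Defs "HOL-Number_Theory.Residues"
begin

text \<open>
  Write \<open>Q = 2 ^ m\<close>, let \<open>S n\<close> be the sum of \<open>(-1) ^ Tr (f x)\<close> over the field with \<open>Q ^ n\<close>
  elements, and let \<open>W\<close> be the set of roots of \<open>Rt\<close>, which has \<open>4 ^ d\<close> elements. The radical of the
  quadratic form \<open>Tr \<circ> f\<close> on that field is the part of \<open>W\<close> contained in it.

  The invariant of a quadratic form over the field with two elements is the sign of its Gauss sum
  (\<open>qf_eps_eq_sgn_gauss_sum\<close>): the square of the Gauss sum is \<open>0\<close> or the product of the sizes of the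
  space and the radical, and a form that vanishes on its radical is determined up to isometry by
  these two sizes and the sign. So the theorem is about the signs of the integers \<open>S n\<close>, of which
  those that do not vanish have a known absolute value. Two relations between them suffice.

  If \<open>p\<close> is an odd prime, \<open>n\<close> is even and the field of \<open>Q ^ (n * p)\<close> elements contains no new element
  of \<open>W\<close>, then \<open>S (n * p)\<close> and \<open>S n\<close> have the same sign. Indeed a Frobenius map acts on the larger
  field with orbits of length \<open>1\<close> or \<open>p\<close>, so the two sums agree modulo \<open>p\<close>; their absolute values
  differ by the factor \<open>2 ^ (m * n * (p - 1) div 2)\<close>, which is \<open>1\<close> modulo \<open>p\<close> because \<open>n\<close> is even, and
  opposite signs, or only one sum being \<open>0\<close>, would make \<open>p\<close> divide a power of \<open>2\<close>
  (\<open>sgn_S_prime_multiple\<close>). As a consequence, if \<open>W\<close> lies in the field of \<open>Q ^ E\<close> elements with \<open>E\<close> even, then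
  \<open>S n\<close> and \<open>S (gcd n E)\<close> have the same sign for all even \<open>n\<close> whose \<open>2\<close>-adic valuation does not
  exceed that of \<open>E\<close> (\<open>sgn_S_gcd\<close>).

  The second relation is \<open>S (n + E) = - sgn (S E) * Q ^ (E / 2) * S n\<close>, for \<open>W\<close> contained in the
  field of \<open>Q ^ E\<close> elements and \<open>S E \<noteq> 0\<close>. The sums \<open>S k\<close> are the coefficients of the logarithmic
  derivative of an \<open>L\<close>-function, which is a polynomial of degree at most \<open>2 ^ d\<close>
  (\<open>L_coeff_recursion\<close>, \<open>L_coeff_eq_0\<close>). Hence \<open>S k = - (\<Sum>i<2 ^ d. z i ^ k)\<close> for complex numbers
  \<open>z i\<close>. The bound \<open>\<bar>S k\<bar> \<le> 2 ^ d * Q ^ (k / 2)\<close>, known from the size of the radical, forces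
  \<open>\<bar>z i\<bar> \<le> sqrt Q\<close>. For \<open>k = E\<close> the bound is attained by a sum of only \<open>2 ^ d\<close> terms, so every
  \<open>z i ^ E\<close> is \<open>- sgn (S E) * Q ^ (E / 2)\<close> (\<open>sgn_S_add_period\<close>).

  The two relations combine as follows (\<open>sign_law\<close>). If \<open>n\<close> has larger valuation than \<open>E\<close>, then
  \<open>n + E\<close> has the valuation of \<open>E\<close> and the same greatest common divisor with \<open>E\<close>, so the first
  relation applies to it and the second returns to \<open>n\<close>. If \<open>n\<close> has smaller valuation than \<open>E\<close> and
  \<open>S E > 0\<close>, the first relation gives \<open>S n\<close> and \<open>S (n + E)\<close> the same sign and the second gives them
  opposite signs, so both vanish. The theorem is the case \<open>E = N\<close> together with the case
  \<open>E = 2 * N\<close>; that \<open>N\<close> is even holds because \<open>m\<close> is odd and an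
  alternating form has even rank (\<open>even_if_W_subset\<close>).
\<close>

section \<open>Gauss sums of quadratic forms over the field with two elements\<close>

(* These rules rewrite sums and products of bits into bit operations, which hides the field
   structure from the simplifier. *)
declare add_bit_eq_xor [simp del] mult_bit_eq_and [simp del]

lemma isometricI:
  fixes V :: "'v::ab_group_add set" and W :: "'w::ab_group_add set"
  assumes "bij_betw \<phi> V W" "\<And>x y. x \<in> V \<Longrightarrow> y \<in> V \<Longrightarrow> \<phi> (x + y) = \<phi> x + \<phi> y"
    and "0 \<in> V" "\<And>x. x \<in> V \<Longrightarrow> q' (\<phi> x) = q x"
  shows "isometric V q W q'"
proof -
  have "\<phi> 0 = 0"
    using assms(2)[of 0 0] assms(3) by simp
  then have "\<phi> (f2_scale c x) = f2_scale c (\<phi> x)" for c x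
    by (simp add: f2_scale_def)
  then show ?thesis
    unfolding isometric_def using assms by blast
qed

text \<open>
  The nontrivial character of the additive group of two elements.
\<close>
definition bit_sign :: "bit \<Rightarrow> int" where
  "bit_sign b = (if b = 0 then 1 else - 1)"

lemma bit_sign_simps [simp]: "bit_sign 0 = 1" "bit_sign 1 = - 1"
  by (simp_all add: bit_sign_def)

lemma bit_sign_add: "bit_sign (a + b) = bit_sign a * bit_sign b"
  by (cases a; cases b) (simp_all add: bit_sign_def)

lemma bit_UNIV: "(UNIV :: bit set) = {0, 1}"
  using bit.exhaust by auto

lemma bit_add_self [simp]: "(b::bit) + b = 0"
  by (cases b) simp_all

lemma bit_add_eq_0_iff [simp]: "(a::bit) + b = 0 \<longleftrightarrow> a = b"
  by (cases a; cases b) simp_all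

definition gauss_sum :: "'v set \<Rightarrow> ('v \<Rightarrow> bit) \<Rightarrow> int" where
  "gauss_sum V q = (\<Sum>x\<in>V. bit_sign (q x))"

lemma gauss_sum_isometric:
  assumes "isometric V q W q'"
  shows "gauss_sum V q = gauss_sum W q'"
proof -
  obtain \<phi> where "bij_betw \<phi> V W" "\<forall>x\<in>V. q' (\<phi> x) = q x"
    using assms by (auto simp: isometric_def)
  then show ?thesis
    unfolding gauss_sum_def
    by (intro sum.reindex_bij_witness[of _ "the_inv_into V \<phi>" \<phi>])
       (auto simp: bij_betw_def the_inv_into_f_f the_inv_into_into f_the_inv_into_f)
qed

text \<open>
  A finite vector space over \<^typ>\<open>bit\<close>, sitting in a group of exponent 2. The exponent is required of
  the whole type because scalar multiplication is a total function on it.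
\<close>
locale f2_group =
  fixes V :: "'v::ab_group_add set"
  assumes exp2: "\<And>x::'v. x + x = 0"
    and fin: "finite V"
    and zero_mem: "0 \<in> V"
    and add_mem: "\<And>x y. x \<in> V \<Longrightarrow> y \<in> V \<Longrightarrow> x + y \<in> V"
begin

declare exp2 [simp]

lemma add_self_left [simp]: "x + (x + y) = (y::'v)"
  by (simp add: add.assoc[symmetric] exp2)

lemma scale_mem: "x \<in> V \<Longrightarrow> f2_scale c x \<in> V"
  by (simp add: f2_scale_def zero_mem)

lemma scale_add: "f2_scale (c + d) x = f2_scale c x + f2_scale d (x::'v)"
  by (cases c; cases d) (simp_all add: f2_scale_def exp2)

lemma translate_sum:
  assumes "a \<in> V"
  shows "(\<Sum>x\<in>V. g (a + x)) = (\<Sum>x\<in>V. g x)"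
  by (rule sum.reindex_bij_witness[of _ "\<lambda>x. a + x" "\<lambda>x. a + x"]) (auto simp: add_mem assms)

text \<open>
  Orthogonality of characters: translation by an element on which \<open>l\<close> is \<open>1\<close> changes the sign of every
  term.
\<close>
lemma sum_bit_sign_additive:
  assumes l: "\<And>x y. x \<in> V \<Longrightarrow> y \<in> V \<Longrightarrow> l (x + y) = l x + l y"
  shows "(\<Sum>x\<in>V. bit_sign (l x)) = (if \<forall>x\<in>V. l x = 0 then int (card V) else 0)"
proof (cases "\<forall>x\<in>V. l x = 0")
  case False
  then obtain a where a: "a \<in> V" "l a = 1"
    by auto
  have "(\<Sum>x\<in>V. bit_sign (l x)) = (\<Sum>x\<in>V. bit_sign (l (a + x)))"
    by (rule translate_sum[symmetric, OF a(1)])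
  also have "\<dots> = - (\<Sum>x\<in>V. bit_sign (l x))"
    unfolding sum_negf[symmetric]
  proof (intro sum.cong refl)
    fix x assume "x \<in> V"
    then show "bit_sign (l (a + x)) = - bit_sign (l x)"
      using l[OF a(1)] a(2) by (simp only: bit_sign_add) simp
  qed
  finally show ?thesis
    using False by auto
qed simp

lemma vector_space_scale: "vector_space (f2_scale :: bit \<Rightarrow> 'v \<Rightarrow> 'v)"
  by (rule vector_space_f2_scale) (rule exp2)

lemma subspace: "module.subspace f2_scale V"
proof -
  interpret vector_space "f2_scale :: bit \<Rightarrow> 'v \<Rightarrow> 'v" by (rule vector_space_scale)
  show ?thesis
    by (rule subspaceI) (auto simp: zero_mem add_mem scale_mem)
qed

text \<open>
  The sums of subsets of a basis run through the space once; this links the dimension to the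
  cardinality, in which the arguments below are phrased.
\<close>
lemma obtain_basis:
  obtains B where "B \<subseteq> V" "finite B" "\<not> module.dependent f2_scale B" "module.span f2_scale B = V"
    "card B = f2_dim V" "card V = 2 ^ f2_dim V"
proof -
  interpret vector_space "f2_scale :: bit \<Rightarrow> 'v \<Rightarrow> 'v" by (rule vector_space_scale)
  obtain B where B: "B \<subseteq> V" "independent B" "V \<subseteq> span B" "card B = dim V"
    using basis_exists by blast
  have finB: "finite B"
    using B(1) fin finite_subset by blast
  have spanB: "span B = V"
    using B span_minimal subspace by blast
  define h where "h = (\<lambda>S. \<Sum>b\<in>S. b :: 'v)"
  have "inj_on h (Pow B)"
  proof (rule inj_onI)
    fix S T assume ST: "S \<in> Pow B" "T \<in> Pow B" "h S = h T"
    have h_eq: "h S = (\<Sum>b\<in>B. f2_scale (of_bool (b \<in> S)) b)" if "S \<in> Pow B" for S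
    proof -
      have "(\<Sum>b\<in>B. f2_scale (of_bool (b \<in> S)) b) = (\<Sum>b\<in>S. f2_scale (of_bool (b \<in> S)) b)"
        using that finB by (intro sum.mono_neutral_right) (auto simp: f2_scale_def)
      also have "\<dots> = h S"
        unfolding h_def by (intro sum.cong) (auto simp: f2_scale_def)
      finally show ?thesis ..
    qed
    have "(\<Sum>b\<in>B. f2_scale (of_bool (b \<in> S) + of_bool (b \<in> T)) b) = h S + h T"
      unfolding scale_add sum.distrib h_eq[OF ST(1)] h_eq[OF ST(2)] ..
    then have "(\<Sum>b\<in>B. f2_scale (of_bool (b \<in> S) + of_bool (b \<in> T)) b) = 0"
      by (simp only: ST(3) exp2)
    then have "\<forall>b\<in>B. of_bool (b \<in> S) + of_bool (b \<in> T) = (0::bit)"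
      using independentD[OF B(2) finB order_refl,
          where u = "\<lambda>b. of_bool (b \<in> S) + of_bool (b \<in> T)"] by blast
    then have "\<forall>b\<in>B. b \<in> S \<longleftrightarrow> b \<in> T"
      by (auto simp: of_bool_def split: if_splits)
    then show "S = T"
      using ST by blast
  qed
  moreover have "h ` Pow B = V"
  proof
    show "h ` Pow B \<subseteq> V"
      using B(1) unfolding h_def by (auto intro!: subspace_sum[OF subspace])
    show "V \<subseteq> h ` Pow B"
    proof
      fix v assume "v \<in> V"
      then obtain u where u: "v = (\<Sum>b\<in>B. f2_scale (u b) b)"
        using spanB span_finite[OF finB] by auto
      have "v = h {b \<in> B. u b = 1}"
        unfolding u h_def using finB by (simp add: f2_scale_def sum.inter_filter)
      then show "v \<in> h ` Pow B"
        by blast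
    qed
  qed
  ultimately have "card V = card (Pow B)"
    using card_image by metis
  then have "card V = 2 ^ card B"
    using finB by (simp add: card_Pow)
  then show ?thesis
    using that[of B] B finB spanB by (simp add: f2_dim_def)
qed

lemma card_eq_power_dim: "card V = 2 ^ f2_dim V"
  by (rule obtain_basis)

end

text \<open>
  Spaces of equal cardinality have bases of equal size, and a bijection of bases extends linearly.
\<close>
lemma f2_group_iso:
  assumes V: "f2_group V" and W: "f2_group W" and card: "card V = card W"
  obtains \<phi> where "bij_betw \<phi> V W" "\<And>x y. \<phi> (x + y) = \<phi> x + \<phi> y"
proof -
  interpret V: f2_group V by fact
  interpret W: f2_group W by fact
  interpret vector_space_pair "f2_scale :: bit \<Rightarrow> 'a \<Rightarrow> 'a" "f2_scale :: bit \<Rightarrow> 'b \<Rightarrow> 'b"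
    unfolding vector_space_pair_def using V.vector_space_scale W.vector_space_scale by auto
  obtain B where B: "finite B" "vs1.independent B" "vs1.span B = V" "card B = f2_dim V"
      "card V = 2 ^ f2_dim V"
    using V.obtain_basis by metis
  obtain C where C: "finite C" "vs2.independent C" "vs2.span C = W" "card C = f2_dim W"
      "card W = 2 ^ f2_dim W"
    using W.obtain_basis by metis
  have "card B = card C"
    using B C card by simp
  then obtain f where f: "bij_betw f B C"
    using B(1) C(1) finite_same_card_bij by blast
  obtain g where g: "Vector_Spaces.linear f2_scale f2_scale g" "\<forall>x\<in>B. g x = f x"
    using linear_independent_extend[OF B(2)] by blast
  have "g ` B = C"
    using f g(2) by (auto simp: bij_betw_def)
  then have img: "g ` V = W"
    using linear_span_image[OF g(1), of B] B C by simp
  then have "bij_betw g V W"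
    by (simp add: bij_betw_def eq_card_imp_inj_on V.fin card)
  then show ?thesis
    using that linear_add[OF g(1)] by blast
qed

lemma polarisation_commute: "polarisation q x y = polarisation q y x"
  unfolding polarisation_def by (simp only: add.commute[of y x] add.assoc add.commute[of "q x"])

text \<open>
  Only biadditivity of the polarisation is demanded: \<open>q (c x) = c\<^sup>2 q x\<close> then follows, as the scalars
  are \<open>0\<close> and \<open>1\<close>.
\<close>
locale quad_form = f2_group V for V :: "'v::ab_group_add set" +
  fixes q :: "'v \<Rightarrow> bit"
  assumes polar_add: "\<And>x y z. x \<in> V \<Longrightarrow> y \<in> V \<Longrightarrow> z \<in> V \<Longrightarrow>
    polarisation q (x + y) z = polarisation q x z + polarisation q y z"
begin

abbreviation "b \<equiv> polarisation q"

lemma polar_add_right: "x \<in> V \<Longrightarrow> y \<in> V \<Longrightarrow> z \<in> V \<Longrightarrow> b z (x + y) = b z x + b z y"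
  by (metis polar_add polarisation_commute)

lemma q_add: "q (x + y) = q x + q y + b x y"
  by (cases "q (x + y)"; cases "q x"; cases "q y"; simp add: polarisation_def)

lemma polar_zero [simp]: "x \<in> V \<Longrightarrow> b 0 x = 0" "x \<in> V \<Longrightarrow> b x 0 = 0"
  using polar_add[of 0 0 x] polar_add_right[of 0 0 x] zero_mem by auto

lemma q_zero [simp]: "q 0 = 0"
  using q_add[of 0 0] zero_mem by simp

lemma polar_self [simp]: "b x x = 0"
  by (simp add: polarisation_def exp2)

lemma polar_scale [simp]:
  "x \<in> V \<Longrightarrow> y \<in> V \<Longrightarrow> b (f2_scale c x) y = c * b x y"
  "x \<in> V \<Longrightarrow> y \<in> V \<Longrightarrow> b y (f2_scale c x) = c * b y x"
  by (cases c; simp add: f2_scale_def)+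

lemma q_scale [simp]: "q (f2_scale c x) = c * q x"
  by (cases c) (simp_all add: f2_scale_def)

lemma radical_subset: "qf_radical V q \<subseteq> V"
  by (auto simp: qf_radical_def)

lemma f2_group_radical: "f2_group (qf_radical V q)"
  using fin zero_mem add_mem
  by unfold_locales (auto simp: qf_radical_def exp2 polar_add)

lemma gauss_sum_radical:
  "gauss_sum (qf_radical V q) q
     = (if \<forall>x\<in>qf_radical V q. q x = 0 then int (card (qf_radical V q)) else 0)"
  unfolding gauss_sum_def
  by (rule f2_group.sum_bit_sign_additive[OF f2_group_radical]) (auto simp: q_add qf_radical_def)

text \<open>
  The substitution \<open>y \<mapsto> x + y\<close> turns the square into a sum over \<open>y\<close> of the character sums of
  \<open>b y\<close>, which vanish unless \<open>y\<close> lies in the radical. On the radical \<open>q\<close> is additive, so it contributes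
  all or nothing.
\<close>
lemma gauss_sum_square:
  "gauss_sum V q ^ 2 = (if \<forall>x\<in>qf_radical V q. q x = 0
     then int (card V * card (qf_radical V q)) else 0)"
proof -
  let ?s = "\<lambda>x. bit_sign (q x)"
  have "gauss_sum V q ^ 2 = (\<Sum>x\<in>V. \<Sum>y\<in>V. ?s x * ?s (x + y))"
    unfolding power2_eq_square gauss_sum_def sum_product sum_distrib_left[symmetric]
    by (intro sum.cong refl) (simp add: translate_sum[of _ "?s"])
  also have "\<dots> = (\<Sum>y\<in>V. \<Sum>x\<in>V. ?s y * bit_sign (b y x))"
    by (subst sum.swap, intro sum.cong refl)
       (simp add: q_add bit_sign_add polarisation_commute, simp add: bit_sign_def)
  also have "\<dots> = (\<Sum>y\<in>V. if y \<in> qf_radical V q then ?s y * int (card V) else 0)"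
    unfolding sum_distrib_left[symmetric]
    by (intro sum.cong refl, subst sum_bit_sign_additive)
       (auto simp: polar_add_right qf_radical_def)
  also have "\<dots> = int (card V) * gauss_sum (qf_radical V q) q"
    using fin radical_subset
    by (simp add: sum.If_cases gauss_sum_def sum_distrib_left Int_absorb1 mult.commute)
  finally show ?thesis
    by (simp add: gauss_sum_radical)
qed

text \<open>
  Let \<open>b e f = 1\<close>. Then \<open>b\<close> is nondegenerate on the plane spanned by \<open>e\<close> and \<open>f\<close>, and the space is the
  orthogonal sum of this plane and \<open>perp e f\<close>. The coordinates of \<open>x\<close> in the plane are \<open>b x f\<close> and
  \<open>b x e\<close>, and \<open>proj e f\<close> removes this part.
\<close>
definition perp :: "'v \<Rightarrow> 'v \<Rightarrow> 'v set" where
  "perp e f = {x \<in> V. b x e = 0 \<and> b x f = 0}"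

definition proj :: "'v \<Rightarrow> 'v \<Rightarrow> 'v \<Rightarrow> 'v" where
  "proj e f x = x + f2_scale (b x f) e + f2_scale (b x e) f"

context
  fixes e f assumes e: "e \<in> V" and f: "f \<in> V" and bef: "b e f = 1"
begin

lemma bfe: "b f e = 1"
  using bef by (simp add: polarisation_commute)

lemma quad_form_perp: "quad_form (perp e f) q"
  using fin zero_mem add_mem e f
  by unfold_locales (auto simp: perp_def exp2 polar_add)

text \<open>
  An element of \<open>perp e f\<close> is orthogonal to the plane, so it lies in the radical as soon as it is
  orthogonal to \<open>perp e f\<close>.
\<close>
lemma radical_perp: "qf_radical (perp e f) q = qf_radical V q"
proof -
  have "b x y = 0" if x: "x \<in> perp e f" "\<And>z. z \<in> perp e f \<Longrightarrow> b x z = 0" and y: "y \<in> V" for x y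
  proof -
    have "proj e f y \<in> perp e f"
      using y e f bef bfe unfolding perp_def proj_def
      by (auto simp: polar_add add_mem scale_mem)
    then have "b x (proj e f y) = 0"
      using x by blast
    then show ?thesis
      using x(1) y e f by (simp add: perp_def proj_def polar_add_right add_mem scale_mem)
  qed
  note perp_imp_radical = this
  have "qf_radical (perp e f) q \<subseteq> qf_radical V q"
  proof
    fix x assume "x \<in> qf_radical (perp e f) q"
    then have x: "x \<in> perp e f" "\<And>z. z \<in> perp e f \<Longrightarrow> b x z = 0"
      unfolding qf_radical_def by blast+
    then have "x \<in> V"
      by (simp add: perp_def)
    with perp_imp_radical[OF x] show "x \<in> qf_radical V q"
      unfolding qf_radical_def by blast
  qed
  moreover have "qf_radical V q \<subseteq> qf_radical (perp e f) q"
    using e f unfolding qf_radical_def perp_def by blast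
  ultimately show ?thesis
    by blast
qed

lemma plane_coordinates:
  assumes "x \<in> perp e f"
  shows "b (f2_scale c e + f2_scale d f + x) f = c" "b (f2_scale c e + f2_scale d f + x) e = d"
    "proj e f (f2_scale c e + f2_scale d f + x) = x"
proof -
  show *: "b (f2_scale c e + f2_scale d f + x) f = c" "b (f2_scale c e + f2_scale d f + x) e = d"
    using assms e f bef bfe by (simp_all add: perp_def polar_add add_mem scale_mem)
  show "proj e f (f2_scale c e + f2_scale d f + x) = x"
    unfolding proj_def * by (simp add: add.commute add.left_commute add.assoc)
qed

lemma proj_mem: "x \<in> V \<Longrightarrow> proj e f x \<in> perp e f"
  using e f bef bfe by (simp add: proj_def perp_def polar_add add_mem scale_mem)

lemma plane_proj: "f2_scale (b x f) e + f2_scale (b x e) f + proj e f x = x"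
  unfolding proj_def by (simp add: add.commute add.left_commute add.assoc)

lemma perp_subset: "perp e f \<subseteq> V"
  by (auto simp: perp_def)

lemma sum_plane:
  "(\<Sum>x\<in>V. g x) = (\<Sum>(c, d, x)\<in>UNIV \<times> UNIV \<times> perp e f. g (f2_scale c e + f2_scale d f + x))"
proof (rule sum.reindex_bij_witness[of _ "\<lambda>(c, d, x). f2_scale c e + f2_scale d f + x"
        "\<lambda>x. (b x f, b x e, proj e f x)"], goal_cases)
  case (4 y)
  then show ?case
    using e f perp_subset by (auto intro!: add_mem scale_mem)
qed (auto simp: plane_coordinates plane_proj proj_mem)

lemma card_perp: "card V = 4 * card (perp e f)"
  using sum_plane[of "\<lambda>_. 1 :: nat"] by (simp add: bit_UNIV card_cartesian_product)

lemma q_plane: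
  assumes "x \<in> perp e f"
  shows "q (f2_scale c e + f2_scale d f + x) = c * q e + d * q f + c * d + q x"
proof -
  have "b (f2_scale c e + f2_scale d f) x = 0" "b (f2_scale c e) (f2_scale d f) = c * d"
    using assms e f bef perp_subset polarisation_commute[of q _ x]
    by (auto simp: polar_add_right scale_mem perp_def)
  then show ?thesis
    by (simp add: q_add)
qed

text \<open>
  The Gauss sum is multiplicative over the orthogonal sum, and the four values of \<open>q\<close> on the plane add
  up to \<open>-2\<close> if \<open>q\<close> is \<open>1\<close> on all three nonzero vectors, and to \<open>2\<close> otherwise.
\<close>
lemma gauss_sum_plane:
  "gauss_sum V q = (if q e = 1 \<and> q f = 1 then - 2 else 2) * gauss_sum (perp e f) q"
proof -
  have "gauss_sum V q = (\<Sum>(c, d, x)\<in>UNIV \<times> UNIV \<times> perp e f.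
      bit_sign (c * q e + d * q f + c * d) * bit_sign (q x))"
    unfolding gauss_sum_def sum_plane
  proof (intro sum.cong refl, clarify)
    fix c d x assume "x \<in> perp e f"
    then show "bit_sign (q (f2_scale c e + f2_scale d f + x)) =
        bit_sign (c * q e + d * q f + c * d) * bit_sign (q x)"
      by (simp only: q_plane bit_sign_add)
  qed
  also have "\<dots> = (\<Sum>c\<in>UNIV. \<Sum>d\<in>UNIV. bit_sign (c * q e + d * q f + c * d)) * gauss_sum (perp e f) q"
    unfolding gauss_sum_def
    by (simp add: sum.cartesian_product[symmetric] sum_distrib_left[symmetric] sum_distrib_right)
  also have "(\<Sum>c\<in>UNIV. \<Sum>d\<in>UNIV. bit_sign (c * q e + d * q f + c * d)) =
      (if q e = 1 \<and> q f = 1 then - 2 else 2)"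
    by (cases "q e"; cases "q f") (simp_all add: bit_UNIV)
  finally show ?thesis .
qed

end

end

section \<open>Isometry classes\<close>

context quad_form begin

lemma radical_eq_all:
  assumes "card (qf_radical V q) = card V"
  shows "qf_radical V q = V"
  using assms card_subset_eq[OF fin radical_subset] by simp

text \<open>
  If \<open>q e = 0\<close>, replacing \<open>f\<close> by \<open>e + f\<close> changes the value of \<open>q f\<close>, so a hyperbolic plane can be
  found through any singular vector outside the radical.
\<close>
lemma obtain_plane:
  assumes rad: "\<forall>x\<in>qf_radical V q. q x = 0" and e: "e \<in> V" "e \<notin> qf_radical V q"
  obtains f where "f \<in> V" "b e f = 1" "q f = q e \<or> q e = 1"
proof -
  obtain f where f: "f \<in> V" "b e f = 1"
    using e by (auto simp: qf_radical_def)
  show ?thesis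
  proof (cases "q f = q e \<or> q e = 1")
    case False
    then have "q e = 0" "q f = 1"
      by (auto split: bit.splits)
    then have "q (e + f) = q e"
      by (simp add: q_add f)
    then show ?thesis
      using that[of "e + f"] f e by (simp add: add_mem polar_add_right)
  qed (use that f in blast)
qed

text \<open>
  Anisotropy outside the radical is visible in the Gauss sum: the right hand side is its least possible
  value. So two forms with the same invariants are both anisotropic or both not.
\<close>
lemma anisotropic_iff:
  assumes rad: "\<forall>x\<in>qf_radical V q. q x = 0"
  shows "(\<forall>x\<in>V - qf_radical V q. q x = 1) \<longleftrightarrow>
    gauss_sum V q = 2 * int (card (qf_radical V q)) - int (card V)"
proof -
  let ?Z = "qf_radical V q"
  have "gauss_sum V q = gauss_sum ?Z q + gauss_sum (V - ?Z) q"
    unfolding gauss_sum_def by (rule sum.subset_diff[OF radical_subset fin, THEN trans]) simp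
  moreover have "gauss_sum (V - ?Z) q = (\<Sum>x\<in>V - ?Z. (bit_sign (q x) + 1) - 1)"
    by (simp add: gauss_sum_def)
  then have "gauss_sum (V - ?Z) q = (\<Sum>x\<in>V - ?Z. bit_sign (q x) + 1) - int (card (V - ?Z))"
    by (simp only: sum_subtractf) simp
  moreover have "int (card (V - ?Z)) = int (card V) - int (card ?Z)"
    using card_Diff_subset[OF finite_subset[OF radical_subset fin] radical_subset]
      card_mono[OF fin radical_subset] by simp
  ultimately have "gauss_sum V q = 2 * int (card ?Z) - int (card V)
      + (\<Sum>x\<in>V - ?Z. bit_sign (q x) + 1)"
    using rad by (simp add: gauss_sum_radical)
  moreover have "(\<Sum>x\<in>V - ?Z. bit_sign (q x) + 1) = 0 \<longleftrightarrow> (\<forall>x\<in>V - ?Z. q x = 1)"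
    using fin by (subst sum_nonneg_eq_0_iff) (auto simp: bit_sign_def)
  ultimately show ?thesis
    by simp
qed

end

text \<open>
  Two planes on which the forms take the same values, together with an isometry of their orthogonal
  complements, give an isometry of the whole spaces. Injectivity suffices because the cardinalities
  agree, and it holds because the plane coordinates and the projection can be read off from the image.
\<close>
lemma isometric_glue:
  assumes V: "quad_form V q" and W: "quad_form W q'" and card: "card V = card W"
    and ef: "e \<in> V" "f \<in> V" "polarisation q e f = 1"
    and ef': "e' \<in> W" "f' \<in> W" "polarisation q' e' f' = 1"
    and q: "q' e' = q e" "q' f' = q f"
    and iso: "isometric (quad_form.perp V q e f) q (quad_form.perp W q' e' f') q'"
  shows "isometric V q W q'"
proof -
  interpret V: quad_form V q by fact
  interpret W: quad_form W q' by fact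
  obtain \<psi> where \<psi>: "bij_betw \<psi> (V.perp e f) (W.perp e' f')"
    "\<And>x y. x \<in> V.perp e f \<Longrightarrow> y \<in> V.perp e f \<Longrightarrow> \<psi> (x + y) = \<psi> x + \<psi> y"
    "\<And>x. x \<in> V.perp e f \<Longrightarrow> q' (\<psi> x) = q x"
    using iso unfolding isometric_def by blast
  have \<psi>_mem: "\<psi> x \<in> W.perp e' f'" if "x \<in> V.perp e f" for x
    using \<psi>(1) that by (auto simp: bij_betw_def)
  define \<phi> where "\<phi> x = f2_scale (V.b x f) e' + f2_scale (V.b x e) f' + \<psi> (V.proj e f x)" for x
  note pm = V.proj_mem[OF ef]
  have coords: "W.b (\<phi> x) f' = V.b x f" "W.b (\<phi> x) e' = V.b x e"
      "W.proj e' f' (\<phi> x) = \<psi> (V.proj e f x)" if "x \<in> V" for x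
    unfolding \<phi>_def by (rule W.plane_coordinates[OF ef' \<psi>_mem[OF pm[OF that]]])+
  have "inj_on \<phi> V"
  proof (rule inj_onI)
    fix x y assume xy: "x \<in> V" "y \<in> V" "\<phi> x = \<phi> y"
    then have eq: "V.b x f = V.b y f" "V.b x e = V.b y e"
      and "\<psi> (V.proj e f x) = \<psi> (V.proj e f y)"
      using coords[OF xy(1)] coords[OF xy(2)] by auto
    then have "V.proj e f x = V.proj e f y"
      using \<psi>(1) pm[OF xy(1)] pm[OF xy(2)] by (auto simp: bij_betw_def dest: inj_onD)
    then show "x = y"
      using V.plane_proj[OF ef] eq by metis
  qed
  moreover have "\<phi> ` V \<subseteq> W"
    using \<psi>_mem[OF pm] W.perp_subset ef'
    by (auto simp: \<phi>_def intro!: W.add_mem W.scale_mem)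
  ultimately have bij: "bij_betw \<phi> V W"
    using card W.fin by (metis bij_betw_def card_image card_subset_eq)
  show ?thesis
  proof (rule isometricI[OF bij _ V.zero_mem])
    fix x y assume xy: "x \<in> V" "y \<in> V"
    have "V.proj e f (x + y) = V.proj e f x + V.proj e f y"
      using xy ef by (simp add: V.proj_def V.polar_add V.scale_add ac_simps)
    then show "\<phi> (x + y) = \<phi> x + \<phi> y"
      using xy ef pm by (simp add: \<phi>_def \<psi>(2) V.polar_add W.scale_add ac_simps)
  next
    fix x assume x: "x \<in> V"
    have "q x = q (f2_scale (V.b x f) e + f2_scale (V.b x e) f + V.proj e f x)"
      by (simp only: V.plane_proj[OF ef])
    also have "\<dots> = V.b x f * q e + V.b x e * q f + V.b x f * V.b x e + q (V.proj e f x)"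
      by (rule V.q_plane[OF ef pm[OF x]])
    also have "\<dots> = q' (\<phi> x)"
      unfolding \<phi>_def W.q_plane[OF ef' \<psi>_mem[OF pm[OF x]]] q \<psi>(3)[OF pm[OF x]] ..
    finally show "q' (\<phi> x) = q x" ..
  qed
qed

text \<open>
  Induction on the size of the space, splitting off matching planes on both sides. If both forms have
  a singular vector outside the radical, hyperbolic planes match; otherwise both forms are \<open>1\<close>
  everywhere outside the radical, so any two nondegenerate planes match. The complements have the same
  invariants again because the Gauss sums are divided by the same factor.
\<close>
lemma isometric_if_same_invariants:
  fixes V :: "'v::ab_group_add set" and W :: "'w::ab_group_add set"
  assumes V: "quad_form V q" and W: "quad_form W q'" and card: "card V = card W"
    and card_rad: "card (qf_radical V q) = card (qf_radical W q')"
    and rad: "\<forall>x\<in>qf_radical V q. q x = 0" "\<forall>x\<in>qf_radical W q'. q' x = 0"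
    and gauss: "gauss_sum V q = gauss_sum W q'"
  shows "isometric V q W q'"
  using assms
proof (induction "card V" arbitrary: V W rule: less_induct)
  case (less V W)
  interpret V: quad_form V q by fact
  interpret W: quad_form W q' by fact
  show ?case
  proof (cases "qf_radical V q = V")
    case True
    then have True': "qf_radical W q' = W"
      using less.prems by (intro W.radical_eq_all) simp
    obtain \<phi> where \<phi>: "bij_betw \<phi> V W" "\<And>x y. \<phi> (x + y) = \<phi> x + \<phi> y"
      using f2_group_iso[OF V.f2_group_axioms W.f2_group_axioms less.prems(3)] by blast
    show ?thesis
    proof (rule isometricI[OF \<phi>(1)])
      fix x assume "x \<in> V"
      then show "q' (\<phi> x) = q x"
        using True True' less.prems(5,6) bij_betwE[OF \<phi>(1)] by metis
    qed (auto simp: \<phi> V.zero_mem)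
  next
    case False
    have "qf_radical W q' \<noteq> W"
      using False V.radical_eq_all less.prems(3,4) by metis
    then have ne: "V - qf_radical V q \<noteq> {}" "W - qf_radical W q' \<noteq> {}"
      using False W.radical_subset V.radical_subset by blast+
    have "\<exists>e f e' f'. e \<in> V \<and> f \<in> V \<and> V.b e f = 1 \<and> e' \<in> W \<and> f' \<in> W \<and> W.b e' f' = 1 \<and>
        q' e' = q e \<and> q' f' = q f"
    proof (cases "\<exists>e\<in>V - qf_radical V q. \<exists>e'\<in>W - qf_radical W q'. q e = 0 \<and> q' e' = 0")
      case True
      then obtain e e' where e: "e \<in> V" "e \<notin> qf_radical V q" "q e = 0"
          "e' \<in> W" "e' \<notin> qf_radical W q'" "q' e' = 0"
        by blast
      obtain f where "f \<in> V" "V.b e f = 1" "q f = 0"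
        using V.obtain_plane[OF less.prems(5) e(1,2)] e(3) by force
      moreover obtain f' where "f' \<in> W" "W.b e' f' = 1" "q' f' = 0"
        using W.obtain_plane[OF less.prems(6) e(4,5)] e(6) by force
      ultimately show ?thesis
        using e by (intro exI[of _ e] exI[of _ f] exI[of _ e'] exI[of _ f']) simp
    next
      case no: False
      have "(\<forall>x\<in>V - qf_radical V q. q x = 1) \<longleftrightarrow> (\<forall>x\<in>W - qf_radical W q'. q' x = 1)"
        using V.anisotropic_iff W.anisotropic_iff less.prems by simp
      with no have aniso: "\<forall>x\<in>V - qf_radical V q. q x = 1" "\<forall>x\<in>W - qf_radical W q'. q' x = 1"
        by (metis bit_not_one_iff)+
      obtain e e' where e: "e \<in> V" "e \<notin> qf_radical V q" "e' \<in> W" "e' \<notin> qf_radical W q'"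
        using ne by blast
      obtain f where f: "f \<in> V" "V.b e f = 1"
        using V.obtain_plane[OF less.prems(5) e(1,2)] by blast
      obtain f' where f': "f' \<in> W" "W.b e' f' = 1"
        using W.obtain_plane[OF less.prems(6) e(3,4)] by blast
      have "f \<notin> qf_radical V q" "f' \<notin> qf_radical W q'"
        using f f' e polarisation_commute[of q] polarisation_commute[of q']
        by (auto simp: qf_radical_def)
      then show ?thesis
        using e f f' aniso by (intro exI[of _ e] exI[of _ f] exI[of _ e'] exI[of _ f']) simp
    qed
    then obtain e f e' f' where ef: "e \<in> V" "f \<in> V" "V.b e f = 1"
        and ef': "e' \<in> W" "f' \<in> W" "W.b e' f' = 1" and q: "q' e' = q e" "q' f' = q f"
      by blast
    have card_perp: "card (V.perp e f) = card (W.perp e' f')"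
      using V.card_perp[OF ef] W.card_perp[OF ef'] less.prems(3) by simp
    have "card V > 0"
      using V.fin V.zero_mem card_gt_0_iff by blast
    then have "card (V.perp e f) < card V"
      using V.card_perp[OF ef] by simp
    moreover have "gauss_sum (V.perp e f) q = gauss_sum (W.perp e' f') q'"
      using V.gauss_sum_plane[OF ef] W.gauss_sum_plane[OF ef'] less.prems(7) q
      by (simp split: if_splits)
    ultimately have "isometric (V.perp e f) q (W.perp e' f') q'"
      using V.quad_form_perp[OF ef] W.quad_form_perp[OF ef'] card_perp less.prems(4-6)
      by (intro less.hyps) (simp_all add: V.radical_perp[OF ef] W.radical_perp[OF ef'])
    then show ?thesis
      by (intro isometric_glue[OF less.prems(1-3) ef ef' q])
  qed
qed

section \<open>The model forms and the invariant\<close>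

text \<open>
  Coordinate spaces with an arbitrary index set, so that coordinates can be added one at a time in
  any order.
\<close>
definition f2_coord :: "nat set \<Rightarrow> (nat \<Rightarrow> bit) set" where
  "f2_coord I = {x. \<forall>i. i \<notin> I \<longrightarrow> x i = 0}"

lemma f2_space_eq: "f2_space k = f2_coord {1..k}"
  by (auto simp: f2_space_def f2_coord_def)

lemma sum_f2_coord_insert:
  fixes g :: "(nat \<Rightarrow> bit) \<Rightarrow> 'c::comm_monoid_add"
  assumes "a \<notin> I"
  shows "(\<Sum>x\<in>f2_coord (insert a I). g x) = (\<Sum>c\<in>UNIV. \<Sum>x\<in>f2_coord I. g (x(a := c)))"
  unfolding sum.cartesian_product
  by (rule sum.reindex_bij_witness[of _ "\<lambda>(c, x). x(a := c)" "\<lambda>x. (x a, x(a := 0))"])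
     (use assms in \<open>auto simp: f2_coord_def fun_eq_iff\<close>)

lemma card_f2_coord:
  assumes "finite I"
  shows "card (f2_coord I) = 2 ^ card I"
  using assms
proof (induction I)
  case empty
  have "f2_coord {} = {\<lambda>_. 0}"
    by (auto simp: f2_coord_def)
  then show ?case
    by simp
next
  case (insert a I)
  then show ?case
    using sum_f2_coord_insert[of a I "\<lambda>_. 1 :: nat"] by (simp add: bit_UNIV)
qed

lemma card_f2_space: "card (f2_space k) = 2 ^ k"
  by (simp add: f2_space_eq card_f2_coord)

lemma f2_group_coord:
  assumes "finite I"
  shows "f2_group (f2_coord I)"
proof
  show "finite (f2_coord I)"
    using card_f2_coord[OF assms] card.infinite by fastforce
qed (auto simp: f2_coord_def fun_eq_iff)

text \<open>
  Each pair of coordinates occurring only in the product \<open>x (2 * j - 1) * x (2 * j)\<close> contributes a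
  factor \<open>1 + 1 + 1 - 1\<close>. The summand \<open>h\<close> accommodates the first two coordinates of the minus form.
\<close>
lemma sum_hyperbolic_planes:
  assumes "finite J" "0 \<notin> J" "I \<inter> (\<Union>j\<in>J. {2 * j - 1, 2 * j}) = {}"
    and h: "\<And>x i c. i \<notin> I \<Longrightarrow> h (x(i := c)) = h x"
  shows "(\<Sum>x\<in>f2_coord (I \<union> (\<Union>j\<in>J. {2 * j - 1, 2 * j})).
           bit_sign (h x + (\<Sum>j\<in>J. x (2 * j - 1) * x (2 * j))))
         = 2 ^ card J * (\<Sum>x\<in>f2_coord I. bit_sign (h x))"
  using assms(1-3)
proof (induction J)
  case (insert j J)
  let ?K = "I \<union> (\<Union>j\<in>J. {2 * j - 1, 2 * j})"
  let ?f = "\<lambda>x::nat \<Rightarrow> bit. \<Sum>j\<in>J. x (2 * j - 1) * x (2 * j)"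
  have j: "j > 0"
    using insert.prems by auto
  have neq: "2 * j - 1 \<noteq> 2 * i" "2 * j - 1 \<noteq> 2 * i - 1" "2 * j \<noteq> 2 * i - 1" "2 * j \<noteq> 2 * i"
    if "i \<in> J" for i
  proof -
    have "i > 0" "i \<noteq> j"
      using that insert by auto
    then show "2 * j - 1 \<noteq> 2 * i" "2 * j - 1 \<noteq> 2 * i - 1" "2 * j \<noteq> 2 * i - 1" "2 * j \<noteq> 2 * i"
      using j by presburger+
  qed
  then have notin: "2 * j - 1 \<notin> ?K" "2 * j \<notin> ?K" and jI: "2 * j - 1 \<notin> I" "2 * j \<notin> I"
    using insert.prems by auto
  have neq_self: "2 * j \<noteq> 2 * j - 1"
    using j by presburger
  have term_eq: "h x + ?f x + x (2 * j - 1) * x (2 * j) = h y + ?f y + c * d"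
    if "x = y(2 * j := d, 2 * j - 1 := c)" for x y c d
  proof -
    have "h x = h y"
      using that h jI by metis
    moreover have "?f x = ?f y"
      using that neq by (intro sum.cong refl) auto
    ultimately show ?thesis
      using that j neq_self by simp
  qed
  have "(\<Sum>x\<in>f2_coord (insert (2 * j - 1) (insert (2 * j) ?K)).
          bit_sign (h x + ?f x + x (2 * j - 1) * x (2 * j)))
      = (\<Sum>c\<in>UNIV. \<Sum>d\<in>UNIV. \<Sum>y\<in>f2_coord ?K. bit_sign (h y + ?f y + c * d))"
    using notin j by (subst sum_f2_coord_insert, simp, subst sum_f2_coord_insert, simp)
      (intro sum.cong refl arg_cong[of _ _ bit_sign] term_eq)
  also have "\<dots> = 2 * (\<Sum>y\<in>f2_coord ?K. bit_sign (h y + ?f y))"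
    by (simp add: bit_UNIV bit_sign_add sum_negf)
  also have "\<dots> = 2 ^ card (insert j J) * (\<Sum>x\<in>f2_coord I. bit_sign (h x))"
    using insert by (simp add: Int_Un_distrib)
  finally show ?case
    using insert.hyps by (simp add: ac_simps)
qed simp

text \<open>
  The common polarisation of both model forms.
\<close>
definition pair_polar :: "nat \<Rightarrow> (nat \<Rightarrow> bit) \<Rightarrow> (nat \<Rightarrow> bit) \<Rightarrow> bit" where
  "pair_polar r x y = (\<Sum>j=1..r div 2. x (2 * j - 1) * y (2 * j) + x (2 * j) * y (2 * j - 1))"

lemma bit_product_polar: "(a + c) * (b + d) + a * b + c * d = a * d + b * (c::bit)"
  by (cases a; cases b; cases c; cases d) simp_all

lemma polarisation_plus_form: "polarisation (plus_form r) x y = pair_polar r x y"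
  by (simp add: polarisation_def plus_form_def pair_polar_def sum.distrib[symmetric]
      bit_product_polar)

lemma minus_form_eq:
  assumes "r \<ge> 2"
  shows "minus_form r x = x 1 + x 2 + plus_form r x"
proof -
  have "{1..r div 2} = insert 1 {2..r div 2}"
    using assms by auto
  moreover have "b ^ 2 = b" for b :: bit
    by (cases b) simp_all
  ultimately show ?thesis
    by (simp add: minus_form_def plus_form_def ac_simps numeral_2_eq_2)
qed

lemma polarisation_minus_form:
  assumes "r \<ge> 2"
  shows "polarisation (minus_form r) x y = pair_polar r x y"
proof -
  have "polarisation (minus_form r) x y = polarisation (plus_form r) x y
      + ((x 1 + x 1) + (x 2 + x 2)) + ((y 1 + y 1) + (y 2 + y 2))"
    by (simp only: polarisation_def minus_form_eq[OF assms] plus_fun_def ac_simps)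
  then show ?thesis
    by (simp add: polarisation_plus_form)
qed

lemma quad_form_pair_polar:
  assumes "\<And>x y. polarisation q x y = pair_polar r x y"
  shows "quad_form (f2_space k) q"
proof -
  interpret f2_group "f2_space k"
    by (simp add: f2_space_eq f2_group_coord)
  show ?thesis
    by unfold_locales
      (simp add: assms pair_polar_def sum.distrib[symmetric] algebra_simps)
qed

text \<open>
  Pairing with the unit vector at the partner index shows that each of the first \<open>r\<close> coordinates of an
  element of the radical vanishes.
\<close>
lemma qf_radical_pair_polar:
  assumes "\<And>x y. polarisation q x y = pair_polar r x y" "r \<le> k" "even r"
  shows "qf_radical (f2_space k) q = f2_coord {r+1..k}"
proof (intro equalityI subsetI)
  fix x assume x: "x \<in> qf_radical (f2_space k) q"
  have "x i = 0" if i: "i \<notin> {r+1..k}" for i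
  proof (cases "i \<in> {1..k}")
    case True
    define j where "j = (i + 1) div 2"
    have j: "j \<in> {1..r div 2}" "i = 2 * j - 1 \<or> i = 2 * j"
      using True i assms(2,3) unfolding j_def by auto
    define y :: "nat \<Rightarrow> bit" where "y = (\<lambda>_. 0)(if i = 2 * j then 2 * j - 1 else 2 * j := 1)"
    have "y \<in> f2_space k"
      using j assms by (auto simp: y_def f2_space_def)
    then have "pair_polar r x y = 0"
      using x by (simp add: qf_radical_def assms(1))
    moreover have "pair_polar r x y = (\<Sum>l=1..r div 2. if l = j then x i else 0)"
      unfolding pair_polar_def
    proof (intro sum.cong refl)
      fix l assume "l \<in> {1..r div 2}"
      then have "2 * l \<noteq> 2 * j - 1" "2 * l - 1 \<noteq> 2 * j" "2 * l - 1 = 2 * j - 1 \<longleftrightarrow> l = j"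
        using j(1) by (simp_all, presburger+)
      then show "x (2 * l - 1) * y (2 * l) + x (2 * l) * y (2 * l - 1) = (if l = j then x i else 0)"
        using j by (auto simp: y_def)
    qed
    ultimately show ?thesis
      using j by simp
  qed (use x in \<open>auto simp: qf_radical_def f2_space_def\<close>)
  then show "x \<in> f2_coord {r+1..k}"
    by (simp add: f2_coord_def)
next
  fix x assume x: "x \<in> f2_coord {r+1..k}"
  then have "x i = 0" if "i \<le> r" for i
    using that by (auto simp: f2_coord_def)
  then have "pair_polar r x y = 0" for y
    unfolding pair_polar_def by (intro sum.neutral) auto
  then show "x \<in> qf_radical (f2_space k) q"
    using x assms(2) by (auto simp: qf_radical_def assms(1) f2_space_def f2_coord_def)
qed

lemma plus_form_eq_0: "(\<And>i. i \<le> r \<Longrightarrow> x i = 0) \<Longrightarrow> plus_form r x = 0"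
  unfolding plus_form_def by (intro sum.neutral) auto

lemma atLeastAtMost_pairs:
  fixes l r :: nat
  assumes "l \<ge> 1" "even r"
  shows "(\<Union>j\<in>{l..r div 2}. {2 * j - 1, 2 * j}) = {2 * l - 1..r}"
proof (intro equalityI subsetI)
  fix i assume i: "i \<in> {2 * l - 1..r}"
  then have "(i + 1) div 2 \<in> {l..r div 2}" "i = 2 * ((i + 1) div 2) - 1 \<or> i = 2 * ((i + 1) div 2)"
    using assms by auto
  then show "i \<in> (\<Union>j\<in>{l..r div 2}. {2 * j - 1, 2 * j})"
    by blast
qed (use assms in auto)

lemma gauss_sum_plus_form:
  assumes "r \<le> k" "even r"
  shows "gauss_sum (f2_space k) (plus_form r) = 2 ^ (k - r div 2)"
proof -
  have "(\<Sum>x\<in>f2_coord ({r+1..k} \<union> (\<Union>j\<in>{1..r div 2}. {2 * j - 1, 2 * j})).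
          bit_sign (0 + plus_form r x)) = 2 ^ card {1..r div 2} * (\<Sum>x\<in>f2_coord {r+1..k}. bit_sign 0)"
    unfolding plus_form_def
    by (rule sum_hyperbolic_planes) (use assms in auto)
  moreover have "{r+1..k} \<union> (\<Union>j\<in>{1..r div 2}. {2 * j - 1, 2 * j}) = {1..k}"
    using assms by (subst atLeastAtMost_pairs) auto
  moreover have "r div 2 + (k - r) = k - r div 2"
    using assms by auto
  ultimately show ?thesis
    by (simp add: gauss_sum_def f2_space_eq card_f2_coord power_add[symmetric])
qed

lemma gauss_sum_minus_form:
  assumes "r \<le> k" "even r" "r \<ge> 2"
  shows "gauss_sum (f2_space k) (minus_form r) = - (2 ^ (k - r div 2))"
proof -
  let ?h = "\<lambda>x::nat \<Rightarrow> bit. x 1 ^ 2 + x 1 * x 2 + x 2 ^ 2"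
  have zero: "x 1 = 0 \<and> x 2 = 0" if "x \<in> f2_coord {r+1..k}" for x
    using that assms by (auto simp: f2_coord_def)
  have "(\<Sum>x\<in>f2_coord ({1, 2} \<union> {r+1..k} \<union> (\<Union>j\<in>{2..r div 2}. {2 * j - 1, 2 * j})).
          bit_sign (minus_form r x))
      = 2 ^ card {2..r div 2} * (\<Sum>x\<in>f2_coord ({1, 2} \<union> {r+1..k}). bit_sign (?h x))"
    unfolding minus_form_def
    by (rule sum_hyperbolic_planes) (use assms in auto)
  moreover have "{1, 2} \<union> {r+1..k} \<union> (\<Union>j\<in>{2..r div 2}. {2 * j - 1, 2 * j}) = {1..k}"
    using assms by (subst atLeastAtMost_pairs) auto
  moreover have "(\<Sum>x\<in>f2_coord (insert 1 (insert 2 {r+1..k})). bit_sign (?h x)) =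
      (\<Sum>c\<in>UNIV. \<Sum>d\<in>UNIV. \<Sum>x\<in>f2_coord {r+1..k}. bit_sign (c ^ 2 + c * d + d ^ 2))"
    using assms by (subst sum_f2_coord_insert, simp, subst sum_f2_coord_insert, simp)
      (intro sum.cong refl, simp)
  then have "(\<Sum>x\<in>f2_coord ({1, 2} \<union> {r+1..k}). bit_sign (?h x)) = - 2 * 2 ^ (k - r)"
    by (simp add: bit_UNIV card_f2_coord)
  moreover have "Suc (r div 2 + k - Suc r) = k - r div 2"
    using assms by (auto elim!: evenE)
  ultimately show ?thesis
    using assms by (simp add: gauss_sum_def f2_space_eq power_add[symmetric] flip: power_Suc)
qed

text \<open>
  If \<open>q\<close> vanishes on the radical, the square of the Gauss sum is \<open>2 ^ (k + c)\<close>. As this is the square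
  of an integer, \<open>k + c\<close> is even, and the Gauss sum is one of the two square roots, which are the Gauss
  sums of the two model forms. If \<open>q\<close> does not vanish on the radical, the Gauss sum and the invariant
  are both \<open>0\<close>.
\<close>
theorem qf_eps_eq_sgn_gauss_sum:
  assumes "quad_form V q"
  shows "qf_eps V q = sgn (gauss_sum V q)"
proof -
  interpret quad_form V q by fact
  interpret rad: f2_group "qf_radical V q" by (rule f2_group_radical)
  define k c where "k = f2_dim V" and "c = f2_dim (qf_radical V q)"
  define r where "r = k - c"
  have card: "card V = 2 ^ k" "card (qf_radical V q) = 2 ^ c"
    by (simp_all add: k_def c_def card_eq_power_dim rad.card_eq_power_dim)
  have "c \<le> k"
    using card_mono[OF fin radical_subset] by (simp add: card)
  show ?thesis
  proof (cases "\<forall>x\<in>qf_radical V q. q x = 0")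
    case False
    have "gauss_sum V q ^ 2 = 0"
      by (rule gauss_sum_square[unfolded if_not_P[OF False]])
    then show ?thesis
      using False by (auto simp: qf_eps_def)
  next
    case True
    then have sq: "gauss_sum V q ^ 2 = 2 ^ (k + c)"
      using gauss_sum_square by (simp add: card power_add)
    have "even (k + c)"
    proof (rule ccontr)
      assume "odd (k + c)"
      then have "multiplicity 2 (gauss_sum V q ^ 2) = 2 * multiplicity 2 (gauss_sum V q)"
        using sq by (intro prime_elem_multiplicity_power_distrib) auto
      then show False
        using \<open>odd (k + c)\<close> by (simp add: sq)
    qed
    then obtain t where t: "k + c = 2 * t"
      by (elim evenE)
    then have "r = 2 * (k - t)"
      using \<open>c \<le> k\<close> by (simp add: r_def)
    then have r: "even r" "r \<le> k" "k - r = c" and exp: "k + c = 2 * (k - r div 2)"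
      using t \<open>c \<le> k\<close> by (auto simp: r_def)
    have "gauss_sum V q ^ 2 = (2 ^ (k - r div 2)) ^ 2"
      by (simp add: sq exp power_mult[symmetric] mult.commute)
    then consider "gauss_sum V q = 2 ^ (k - r div 2)" | "gauss_sum V q = - (2 ^ (k - r div 2))"
      by (auto simp: power2_eq_iff)
    then show ?thesis
    proof cases
      case 1
      have "isometric V q (f2_space k) (plus_form r)"
      proof (rule isometric_if_same_invariants[OF assms])
        show "quad_form (f2_space k) (plus_form r)"
          using polarisation_plus_form by (rule quad_form_pair_polar)
        have *: "qf_radical (f2_space k) (plus_form r) = f2_coord {r+1..k}"
          using polarisation_plus_form r(2,1) by (rule qf_radical_pair_polar)
        show "card (qf_radical V q) = card (qf_radical (f2_space k) (plus_form r))"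
          by (simp add: * card card_f2_coord r)
        show "\<forall>x\<in>qf_radical (f2_space k) (plus_form r). plus_form r x = 0"
          unfolding * by (auto simp: f2_coord_def intro!: plus_form_eq_0)
      qed (use True 1 r in \<open>simp_all add: card card_f2_space gauss_sum_plus_form\<close>)
      then show ?thesis
        using True 1 by (simp add: qf_eps_def k_def c_def r_def)
    next
      case 2
      have not_plus: "\<not> isometric V q (f2_space k) (plus_form r)"
        using gauss_sum_isometric[of V q "f2_space k" "plus_form r"] gauss_sum_plus_form[OF r(2,1)] 2
        by auto
      \<comment> \<open>A form with \<open>r = 0\<close> is zero, so its Gauss sum is positive.\<close>
      have "r \<noteq> 0"
      proof
        assume "r = 0"
        then have "qf_radical V q = V"
          using \<open>c \<le> k\<close> by (intro card_subset_eq[OF fin radical_subset]) (simp add: card r_def)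
        then have "gauss_sum V q > 0"
          using True gauss_sum_radical by (simp add: card)
        with 2 show False
          by simp
      qed
      then have "r \<ge> 2"
        using r(1) by (auto elim!: evenE)
      note pol = polarisation_minus_form[OF this]
      have "isometric V q (f2_space k) (minus_form r)"
      proof (rule isometric_if_same_invariants[OF assms])
        show "quad_form (f2_space k) (minus_form r)"
          using pol by (rule quad_form_pair_polar)
        have *: "qf_radical (f2_space k) (minus_form r) = f2_coord {r+1..k}"
          using pol r(2,1) by (rule qf_radical_pair_polar)
        show "card (qf_radical V q) = card (qf_radical (f2_space k) (minus_form r))"
          by (simp add: * card card_f2_coord r)
        show "\<forall>x\<in>qf_radical (f2_space k) (minus_form r). minus_form r x = 0"
          unfolding * using \<open>r \<ge> 2\<close>
          by (auto simp: f2_coord_def minus_form_eq intro!: plus_form_eq_0)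
      qed (use True 2 r \<open>r \<ge> 2\<close> in \<open>simp_all add: card card_f2_space gauss_sum_minus_form\<close>)
      then show ?thesis
        using True 2 not_plus \<open>r \<ge> 2\<close> by (simp add: qf_eps_def k_def c_def r_def)
    qed
  qed
qed

section \<open>Finite fields of characteristic 2\<close>

lemma prod_linear_nonzero: "(\<Prod>x\<in>#A. [:-x, 1:]) \<noteq> (0 :: 'a::idom poly)"
  by (auto simp: prod_mset_zero_iff)

lemma proots_prod_linear: "proots (\<Prod>x\<in>#A. [:-x, 1:] :: 'a::idom poly) = A"
proof (induction A)
  case (add x A)
  then show ?case
    using prod_linear_nonzero[of A]
    by (simp add: proots_mult no_zero_divisors del: mult_pCons_left)
qed simp

lemma size_proots_alg_closed: "size (proots (p :: 'a::alg_closed_field poly)) = degree p"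
proof (cases "p = 0")
  case False
  then obtain A where A: "size A = degree p" "p = smult (lead_coeff p) (\<Prod>x\<in>#A. [:-x, 1:])"
    using alg_closed_imp_factorization by blast
  then have "proots p = A"
    using False by (metis leading_coeff_0_iff proots_smult proots_prod_linear)
  then show ?thesis
    using A by simp
qed simp

text \<open>
  A multiple root would be a root of the derivative.
\<close>
lemma card_roots_if_pderiv_const:
  fixes p :: "'a::alg_closed_field poly"
  assumes "pderiv p = [:c:]" "c \<noteq> 0"
  shows "card {x. poly p x = 0} = degree p"
proof -
  have p: "p \<noteq> 0"
    using assms by auto
  have "order x p = 1" if "poly p x = 0" for x
  proof -
    have "\<not> [:-x, 1:] ^ 2 dvd p"
    proof
      assume "[:-x, 1:] ^ 2 dvd p"
      then obtain r where r: "p = [:-x, 1:] ^ 2 * r" ..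
      have "poly (pderiv p) x = 0"
        unfolding r power2_eq_square mult.assoc by (simp add: pderiv_mult del: mult_pCons_left)
      with assms show False
        by simp
    qed
    then have "order x p < 2"
      using order_1[of x p] power_le_dvd not_le by blast
    moreover have "order x p \<noteq> 0"
      using that p by (simp add: order_root)
    ultimately show ?thesis
      by simp
  qed
  then have "size (proots p) = (\<Sum>x\<in>{x. poly p x = 0}. 1)"
    using p by (simp add: size_multiset_overloaded_eq)
  then show ?thesis
    by (simp add: size_proots_alg_closed)
qed

text \<open>
  The type parameter is fixed only to make the characteristic available as an assumption on it.
\<close>
locale char2_field =
  fixes ty :: "'a::alg_closed_field itself"
  assumes char2: "CHAR('a) = 2"
begin

lemma two_eq_0 [simp]: "(2::'a) = 0"
  using of_nat_CHAR[where 'a='a] by (simp add: char2)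

lemma add_self [simp]: "x + x = (0::'a)"
  using mult_2[of x] by simp

lemma add_self_left [simp]: "x + (x + y) = (y::'a)"
  by (simp add: add.assoc[symmetric])

lemma uminus_eq [simp]: "- x = (x::'a)"
  using add_self minus_unique by blast

lemma minus_eq: "x - y = x + (y::'a)"
  unfolding diff_conv_add_uminus by simp

lemma add_eq_0_iff_eq: "x + y = 0 \<longleftrightarrow> x = (y::'a)"
  using eq_iff_diff_eq_0[of x y] by (simp add: minus_eq)

lemma frob_add: "(x + y :: 'a) ^ (2 ^ k) = x ^ (2 ^ k) + y ^ (2 ^ k)"
  by (rule freshmans_dream'[where n = k]) (simp_all add: char2)

lemma frob_sum: "(\<Sum>i\<in>A. g i :: 'a) ^ (2 ^ k) = (\<Sum>i\<in>A. g i ^ (2 ^ k))"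
  by (rule freshmans_dream_sum'[where n = k]) (simp_all add: char2)

lemma frob_frob: "(x ^ (2 ^ j)) ^ (2 ^ k) = (x::'a) ^ (2 ^ (j + k))"
  by (simp add: power_add power_mult)

lemma frob_inject: "x ^ (2 ^ k) = y ^ (2 ^ k) \<longleftrightarrow> x = (y::'a)"
proof
  assume "x ^ (2 ^ k) = y ^ (2 ^ k)"
  then have "(x + y) ^ (2 ^ k) = 0"
    by (simp add: frob_add)
  then show "x = y"
    by (simp add: add_eq_0_iff_eq)
qed simp

lemma gf2_zero [simp]: "(0::'a) \<in> gf2 k"
  by (simp add: gf2_def)

lemma gf2_add: "x \<in> gf2 k \<Longrightarrow> y \<in> gf2 k \<Longrightarrow> x + y \<in> (gf2 k :: 'a set)"
  by (simp add: gf2_def frob_add)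

lemma gf2_mult: "x \<in> gf2 k \<Longrightarrow> y \<in> gf2 k \<Longrightarrow> x * y \<in> (gf2 k :: 'a set)"
  by (simp add: gf2_def power_mult_distrib)

lemma gf2_divide: "x \<in> gf2 k \<Longrightarrow> y \<in> gf2 k \<Longrightarrow> x / y \<in> (gf2 k :: 'a set)"
  by (simp add: gf2_def power_divide)

lemma gf2_power: "x \<in> gf2 k \<Longrightarrow> x ^ j \<in> (gf2 k :: 'a set)"
  by (simp add: gf2_def power_mult[symmetric] mult.commute[of j]) (simp add: power_mult)

lemma gf2_sum: "(\<And>i. i \<in> A \<Longrightarrow> g i \<in> gf2 k) \<Longrightarrow> (\<Sum>i\<in>A. g i) \<in> (gf2 k :: 'a set)"
  by (induction A rule: infinite_finite_induct) (auto intro: gf2_add)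

lemma gf2_frob_mult: "x \<in> gf2 k \<Longrightarrow> x ^ (2 ^ (k * j)) = (x::'a)"
  by (induction j) (simp_all add: gf2_def frob_frob[symmetric])

lemma gf2_mono: "k dvd l \<Longrightarrow> gf2 k \<subseteq> (gf2 l :: 'a set)"
  using gf2_frob_mult by (fastforce simp: gf2_def[of l] elim: dvdE)

text \<open>
  The Euclidean algorithm on the exponents, which works because the Frobenius map is injective.
\<close>
lemma gf2_inter_gcd:
  assumes "x \<in> gf2 k" "x \<in> gf2 l"
  shows "(x::'a) \<in> gf2 (gcd k l)"
  using assms
proof (induction "k + l" arbitrary: k l rule: less_induct)
  case less
  have step: "x \<in> gf2 (l' - k')" if "k' \<le> l'" "x \<in> gf2 k'" "x \<in> gf2 l'" for k' l'
  proof -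
    have "(x ^ (2 ^ (l' - k'))) ^ (2 ^ k') = x ^ (2 ^ k')"
      using that by (simp add: frob_frob gf2_def)
    then show ?thesis
      unfolding frob_inject by (simp add: gf2_def)
  qed
  consider "k = 0 \<or> l = 0" | "0 < k" "k \<le> l" | "0 < l" "l \<le> k"
    by linarith
  then show ?case
  proof cases
    case 2
    then have "x \<in> gf2 (gcd k (l - k))"
      using less.prems by (intro less.hyps step) auto
    then show ?thesis
      using 2 by (metis gcd.commute gcd_diff1_nat)
  next
    case 3
    then have "x \<in> gf2 (gcd (k - l) l)"
      using less.prems by (intro less.hyps step) auto
    then show ?thesis
      using 3 by (simp add: gcd_diff1_nat)
  qed (use less.prems in auto)
qed

lemma degree_frob_minus_id:
  assumes "k \<ge> 1"
  shows "degree (monom 1 (2 ^ k) + monom 1 1 :: 'a poly) = 2 ^ k"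
proof -
  have "(1::nat) < 2 ^ k"
    using one_less_power[of "2 :: nat" k] assms by simp
  then show ?thesis
    by (subst degree_add_eq_left) (simp_all add: degree_monom_eq)
qed

lemma card_gf2:
  assumes "k \<ge> 1"
  shows "card (gf2 k :: 'a set) = 2 ^ k"
proof -
  let ?p = "monom 1 (2 ^ k) + monom 1 1 :: 'a poly"
  have "(of_nat (2 ^ k) :: 'a) = 0"
    using assms by (simp add: power_0_left)
  then have "pderiv ?p = [:1:]"
    by (simp add: pderiv_add pderiv_monom monom_0)
  moreover have "{x. poly ?p x = 0} = gf2 k"
    by (auto simp: gf2_def poly_monom add_eq_0_iff_eq)
  ultimately show ?thesis
    using card_roots_if_pderiv_const[of ?p 1] degree_frob_minus_id[OF assms] by simp
qed

lemma f2_group_gf2: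
  assumes "k \<ge> 1"
  shows "f2_group (gf2 k :: 'a set)"
  using card_gf2[OF assms] card.infinite[of "gf2 k :: 'a set"]
  by unfold_locales (auto intro: gf2_add)

text \<open>
  The trace as an element of the ambient field, where it is additive without side conditions.
\<close>
definition tr :: "nat \<Rightarrow> 'a \<Rightarrow> 'a" where
  "tr k x = (\<Sum>j<k. x ^ (2 ^ j))"

lemma tr_add: "tr k (x + y) = tr k x + tr k y"
  by (simp add: tr_def frob_add sum.distrib)

lemma tr_zero [simp]: "tr k 0 = 0"
  by (simp add: tr_def power_0_left)

lemma tr_sum: "tr k (\<Sum>i\<in>A. g i) = (\<Sum>i\<in>A. tr k (g i))"
  by (induction A rule: infinite_finite_induct) (simp_all add: tr_add)

lemma tr_square:
  assumes "x \<in> gf2 k"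
  shows "tr k (x ^ 2) = tr k x" "tr k x ^ 2 = tr k x"
proof -
  have "tr k (x ^ 2) + x = (\<Sum>j<Suc k. x ^ (2 ^ j))"
    unfolding sum.lessThan_Suc_shift by (simp add: tr_def power_mult[symmetric] add.commute)
  also have "\<dots> = tr k x + x"
    using assms by (simp add: tr_def gf2_def)
  finally show 1: "tr k (x ^ 2) = tr k x"
    by simp
  have "tr k x ^ (2 ^ 1) = tr k (x ^ (2 ^ 1))"
    unfolding tr_def frob_sum by (simp add: power_mult[symmetric] mult.commute)
  with 1 show "tr k x ^ 2 = tr k x"
    by simp
qed

lemma tr_frob:
  assumes "x \<in> gf2 k"
  shows "tr k (x ^ (2 ^ j)) = tr k x"
proof (induction j)
  case (Suc j)
  have "tr k (x ^ (2 ^ Suc j)) = tr k ((x ^ (2 ^ j)) ^ 2)"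
    by (simp add: power_mult[symmetric] mult.commute)
  also have "\<dots> = tr k x"
    using Suc tr_square(1)[OF gf2_power[OF assms]] by simp
  finally show ?case .
qed simp

lemma tr_cases:
  assumes "x \<in> gf2 k"
  shows "tr k x = 0 \<or> tr k x = 1"
  using tr_square(2)[OF assms] by (simp add: power2_eq_square)

lemma abs_trace_eq: "abs_trace k x = (if tr k x = 0 then 0 else 1)"
  by (simp add: abs_trace_def tr_def)

lemma abs_trace_zero [simp]: "abs_trace k (0::'a) = 0"
  by (simp add: abs_trace_eq)

lemma abs_trace_add:
  assumes "x \<in> gf2 k" "y \<in> gf2 k"
  shows "abs_trace k (x + y) = abs_trace k x + abs_trace k (y::'a)"
  using tr_cases[OF assms(1)] tr_cases[OF assms(2)] by (auto simp: abs_trace_eq tr_add)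

lemma abs_trace_sum:
  assumes "\<And>i. i \<in> A \<Longrightarrow> g i \<in> gf2 k"
  shows "abs_trace k (\<Sum>i\<in>A. g i :: 'a) = (\<Sum>i\<in>A. abs_trace k (g i))"
  using assms
  by (induction A rule: infinite_finite_induct) (simp_all add: abs_trace_add gf2_sum)

lemma abs_trace_frob: "x \<in> gf2 k \<Longrightarrow> abs_trace k (x ^ (2 ^ j)) = abs_trace k (x::'a)"
  by (simp add: abs_trace_eq tr_frob)

text \<open>
  The trace is given by a nonzero polynomial of degree \<open>2 ^ (k - 1)\<close>, which cannot vanish at all
  \<open>2 ^ k\<close> elements.
\<close>
lemma ex_tr_nonzero:
  assumes "k \<ge> 1"
  shows "\<exists>x\<in>gf2 k. tr k x \<noteq> 0"
proof (rule ccontr)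
  assume no: "\<not> (\<exists>x\<in>gf2 k. tr k x \<noteq> 0)"
  let ?p = "\<Sum>j<k. monom 1 (2 ^ j) :: 'a poly"
  have "poly ?p x = tr k x" for x
    by (simp add: tr_def poly_sum poly_monom)
  then have sub: "gf2 k \<subseteq> {x. poly ?p x = 0}"
    using no by auto
  have "coeff ?p 1 = (\<Sum>j<k. if j = 0 then 1 else 0)"
    unfolding coeff_sum by (intro sum.cong) auto
  then have p: "?p \<noteq> 0"
    using assms by auto
  have "card (gf2 k :: 'a set) \<le> card {x. poly ?p x = 0}"
    by (rule card_mono[OF poly_roots_finite[OF p] sub])
  also have "\<dots> \<le> degree ?p"
    using card_poly_roots_bound[OF p] .
  also have "\<dots> \<le> 2 ^ (k - 1)"
    by (rule degree_sum_le) (auto simp: degree_monom_eq intro!: power_increasing)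
  also have "\<dots> < 2 ^ k"
    using assms by simp
  finally show False
    using card_gf2[OF assms] by simp
qed

lemma ex_abs_trace_mult:
  assumes "k \<ge> 1" "z \<in> gf2 k" "z \<noteq> (0::'a)"
  shows "\<exists>y\<in>gf2 k. abs_trace k (y * z) = 1"
proof -
  obtain x :: 'a where "x \<in> gf2 k" "tr k x \<noteq> 0"
    using ex_tr_nonzero[OF assms(1)] by blast
  then show ?thesis
    using assms by (intro bexI[of _ "x / z"]) (auto simp: abs_trace_eq gf2_divide)
qed

text \<open>
  Transitivity of the trace, obtained by splitting the conjugates into blocks.
\<close>
lemma tr_tower: "tr (k * n) x = (\<Sum>i<n. tr k (x ^ (2 ^ (k * i))))"
proof -
  have "tr (k * n) x = (\<Sum>i<n. \<Sum>j = i * k..<i * k + k. x ^ (2 ^ j))"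
    unfolding tr_def sum.nat_group by (simp add: mult.commute)
  also have "\<dots> = (\<Sum>i<n. tr k (x ^ (2 ^ (k * i))))"
  proof (intro sum.cong refl)
    fix i
    show "(\<Sum>j = i * k..<i * k + k. x ^ (2 ^ j)) = tr k (x ^ (2 ^ (k * i)))"
      unfolding tr_def frob_frob
      by (rule sum.reindex_bij_witness[of _ "\<lambda>j. j + i * k" "\<lambda>j. j - i * k"])
        (auto simp: ac_simps)
  qed
  finally show ?thesis .
qed

end

section \<open>The quadratic form given by the trace of \<open>x R(x)\<close>\<close>

lemma pderiv_sum: "pderiv (\<Sum>i\<in>A. p i) = (\<Sum>i\<in>A. pderiv (p i))"
  by (induction A rule: infinite_finite_induct) (simp_all add: pderiv_add)

locale trace_form = char2_field ty for ty :: "'a::alg_closed_field itself" +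
  fixes m d :: nat and a :: "nat \<Rightarrow> 'a"
  assumes m_pos: "m \<ge> 1" and d_pos: "d \<ge> 1"
    and coeff_mem: "\<And>i. i \<le> d \<Longrightarrow> a i \<in> gf2 m" and lead: "a d \<noteq> 0"
begin

text \<open>
  \<open>F\<close> is the polynomial function \<open>x R(x)\<close>, \<open>B\<close> its polarisation in the ambient field, \<open>q n\<close> the quadratic
  form on the extension of degree \<open>n\<close> of the base field, and \<open>S n\<close> the Gauss sum of \<open>q n\<close>.
\<close>
definition F :: "'a \<Rightarrow> 'a" where
  "F x = (\<Sum>i\<le>d. a i * x ^ (2 ^ i + 1))"

definition B :: "'a \<Rightarrow> 'a \<Rightarrow> 'a" where
  "B x y = (\<Sum>i\<le>d. a i * x * y ^ (2 ^ i) + a i * x ^ (2 ^ i) * y)"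

definition Rtilde :: "'a \<Rightarrow> 'a" where
  "Rtilde x = (\<Sum>i\<le>d. a i ^ (2 ^ d) * x ^ (2 ^ (d + i)) + a i ^ (2 ^ (d - i)) * x ^ (2 ^ (d - i)))"

definition W :: "'a set" where
  "W = {x. Rtilde x = 0}"

definition q :: "nat \<Rightarrow> 'a \<Rightarrow> bit" where
  "q n x = abs_trace (m * n) (F x)"

definition S :: "nat \<Rightarrow> int" where
  "S n = gauss_sum (gf2 (m * n)) (q n)"

lemma coeff_mem': "i \<le> d \<Longrightarrow> a i \<in> gf2 (m * n)"
  using coeff_mem gf2_mono[of m "m * n"] by auto

lemma F_mem: "x \<in> gf2 (m * n) \<Longrightarrow> F x \<in> gf2 (m * n)"
  unfolding F_def by (intro gf2_sum gf2_mult gf2_power coeff_mem') auto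

lemma B_mem: "x \<in> gf2 (m * n) \<Longrightarrow> y \<in> gf2 (m * n) \<Longrightarrow> B x y \<in> gf2 (m * n)"
  unfolding B_def by (intro gf2_sum gf2_add gf2_mult gf2_power coeff_mem') auto

lemma Rtilde_mem: "x \<in> gf2 (m * n) \<Longrightarrow> Rtilde x \<in> gf2 (m * n)"
  unfolding Rtilde_def by (intro gf2_sum gf2_add gf2_mult gf2_power coeff_mem') auto

lemma F_frob: "F (x ^ (2 ^ (m * k))) = F x ^ (2 ^ (m * k))"
  unfolding F_def frob_sum
proof (intro sum.cong refl)
  fix i assume "i \<in> {..d}"
  then have "a i ^ (2 ^ (m * k)) = a i"
    using gf2_frob_mult[OF coeff_mem] by simp
  then show "a i * (x ^ 2 ^ (m * k)) ^ (2 ^ i + 1) = (a i * x ^ (2 ^ i + 1)) ^ 2 ^ (m * k)"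
    by (simp add: power_mult_distrib power_mult[symmetric] mult.commute)
qed

lemma F_add: "F (x + y) = F x + F y + B x y"
  unfolding F_def B_def sum.distrib[symmetric]
  by (intro sum.cong refl) (simp add: frob_add algebra_simps)

lemma B_add: "B (x + y) z = B x z + B y z"
  unfolding B_def sum.distrib[symmetric]
  by (intro sum.cong refl) (simp add: frob_add algebra_simps)

lemma polarisation_q:
  assumes "x \<in> gf2 (m * n)" "y \<in> gf2 (m * n)"
  shows "polarisation (q n) x y = abs_trace (m * n) (B x y)"
proof -
  have "q n (x + y) = q n x + q n y + abs_trace (m * n) (B x y)"
    using assms by (simp add: q_def F_add abs_trace_add F_mem B_mem gf2_add)
  then show ?thesis
    by (simp add: polarisation_def ac_simps)
qed

lemma f2_group_field: "n \<ge> 1 \<Longrightarrow> f2_group (gf2 (m * n) :: 'a set)"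
  using m_pos by (intro f2_group_gf2) simp

text \<open>
  This and \<open>radical_eq\<close> are stated for every form with the polarisation of \<open>q n\<close>, because
  \<open>even_if_W_subset\<close> needs them for \<open>q n\<close> plus a linear form.
\<close>
lemma quad_form_if_polarisation:
  assumes "n \<ge> 1"
    and "\<And>x y. x \<in> gf2 (m * n) \<Longrightarrow> y \<in> gf2 (m * n) \<Longrightarrow> polarisation q' x y = abs_trace (m * n) (B x y)"
  shows "quad_form (gf2 (m * n)) q'"
proof -
  interpret f2_group "gf2 (m * n) :: 'a set"
    using assms(1) by (rule f2_group_field)
  show ?thesis
    by unfold_locales (simp add: assms(2) gf2_add B_add abs_trace_add B_mem)
qed

lemma quad_form_q: "n \<ge> 1 \<Longrightarrow> quad_form (gf2 (m * n)) (q n)"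
  by (rule quad_form_if_polarisation) (simp_all add: polarisation_q)

text \<open>
  The trace is invariant under Frobenius, so every term of \<open>B x y\<close> may be raised to the power that turns
  its factor in \<open>y\<close> into \<open>y ^ (2 ^ d)\<close>. This is where \<open>Rtilde\<close> comes from.
\<close>
lemma abs_trace_B:
  assumes x: "x \<in> gf2 (m * n)" and y: "y \<in> gf2 (m * n)"
  shows "abs_trace (m * n) (B x y) = abs_trace (m * n) (y ^ (2 ^ d) * Rtilde x)"
proof -
  let ?T = "abs_trace (m * n) :: 'a \<Rightarrow> bit"
  note mem = gf2_add gf2_mult gf2_power coeff_mem' x y
  have "?T (B x y) = (\<Sum>i\<le>d. ?T (a i * x * y ^ (2 ^ i)) + ?T (a i * x ^ (2 ^ i) * y))"
    unfolding B_def by (subst abs_trace_sum) (auto intro!: sum.cong abs_trace_add mem)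
  also have "\<dots> = (\<Sum>i\<le>d. ?T ((a i * x * y ^ (2 ^ i)) ^ (2 ^ (d - i))) + ?T ((a i * x ^ (2 ^ i) * y) ^ (2 ^ d)))"
    by (intro sum.cong arg_cong2[of _ _ _ _ "(+)"] abs_trace_frob[symmetric]) (auto intro!: mem)
  also have "\<dots> = (\<Sum>i\<le>d. ?T (y ^ (2 ^ d) * (a i ^ (2 ^ (d - i)) * x ^ (2 ^ (d - i))))
      + ?T (y ^ (2 ^ d) * (a i ^ (2 ^ d) * x ^ (2 ^ (d + i)))))"
    by (intro sum.cong arg_cong2[of _ _ _ _ "(+)"] arg_cong[of _ _ ?T])
       (auto simp: power_mult_distrib frob_frob ac_simps)
  also have "\<dots> = ?T (y ^ (2 ^ d) * Rtilde x)"
    unfolding Rtilde_def sum_distrib_left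
    by (subst abs_trace_sum) (auto intro!: sum.cong mem simp: distrib_left abs_trace_add mem ac_simps)
  finally show ?thesis .
qed

lemma frob_surj:
  assumes "(z::'a) \<in> gf2 (m * n)" "n \<ge> 1"
  obtains y where "y \<in> gf2 (m * n)" "y ^ (2 ^ d) = z"
proof -
  have "m * n \<ge> 1"
    using assms(2) m_pos by simp
  then have "d \<le> m * n * d"
    by simp
  then have "(z ^ (2 ^ (m * n * d - d))) ^ (2 ^ d) = z"
    using gf2_frob_mult[OF assms(1), of d] by (simp add: frob_frob)
  then show ?thesis
    using that gf2_power[OF assms(1)] by blast
qed

text \<open>
  The pairing \<open>Tr (x y)\<close> is nondegenerate and every element is of the form \<open>y ^ (2 ^ d)\<close>, so \<open>x\<close> is orthogonal to
  everything if and only if \<open>Rtilde x = 0\<close>.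
\<close>
lemma radical_eq:
  assumes n: "n \<ge> 1"
    and pol: "\<And>x y. x \<in> gf2 (m * n) \<Longrightarrow> y \<in> gf2 (m * n) \<Longrightarrow> polarisation q' x y = abs_trace (m * n) (B x y)"
  shows "qf_radical (gf2 (m * n)) q' = W \<inter> gf2 (m * n)"
proof (intro equalityI subsetI)
  fix x assume x: "x \<in> qf_radical (gf2 (m * n)) q'"
  then have mem: "x \<in> gf2 (m * n)"
    by (simp add: qf_radical_def)
  have "Rtilde x = 0"
  proof (rule ccontr)
    assume "Rtilde x \<noteq> 0"
    then obtain z where z: "z \<in> gf2 (m * n)" "abs_trace (m * n) (z * Rtilde x) = 1"
      using ex_abs_trace_mult[of "m * n" "Rtilde x"] Rtilde_mem[OF mem] n m_pos by auto
    obtain y where y: "y \<in> gf2 (m * n)" "y ^ (2 ^ d) = z"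
      using frob_surj[OF z(1) n] .
    then have "polarisation q' x y = 1"
      using z(2) mem by (simp add: pol abs_trace_B)
    with x y(1) show False
      by (simp add: qf_radical_def)
  qed
  with mem show "x \<in> W \<inter> gf2 (m * n)"
    by (simp add: W_def)
next
  fix x assume "x \<in> W \<inter> gf2 (m * n)"
  then show "x \<in> qf_radical (gf2 (m * n)) q'"
    by (simp add: qf_radical_def pol abs_trace_B W_def)
qed

definition Rtilde_poly :: "'a poly" where
  "Rtilde_poly = (\<Sum>i\<le>d. monom (a i ^ (2 ^ d)) (2 ^ (d + i)) + monom (a i ^ (2 ^ (d - i))) (2 ^ (d - i)))"

lemma W_eq_roots: "W = {x. poly Rtilde_poly x = 0}"
  by (simp add: W_def Rtilde_def Rtilde_poly_def poly_sum poly_monom)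

text \<open>
  The only odd exponent is that of the linear term \<open>a d * X\<close>, so the derivative of the polynomial is the
  constant \<open>a d\<close> and there are as many roots as the degree \<open>2 ^ (2 * d)\<close> says.
\<close>
lemma card_W: "card W = 4 ^ d"
proof -
  have of_nat: "(of_nat (2 ^ k) :: 'a) = (if k = 0 then 1 else 0)" for k
    by (simp add: power_0_left)
  have "pderiv Rtilde_poly = (\<Sum>i\<le>d. if i = d then [:a d:] else 0)"
    unfolding Rtilde_poly_def pderiv_sum
    using d_pos by (intro sum.cong refl) (auto simp: pderiv_add pderiv_monom of_nat monom_0 simp del: of_nat_power)
  then have pd: "pderiv Rtilde_poly = [:a d:]"
    by simp
  have lt: "i < d \<Longrightarrow> (2::nat) ^ (d + i) < 2 ^ (2 * d)" "(2::nat) ^ (d - i) < 2 ^ (2 * d)" for i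
    using d_pos by (auto intro!: power_strict_increasing)
  have "coeff Rtilde_poly (2 ^ (2 * d)) = (\<Sum>i\<le>d. if i = d then a d ^ (2 ^ d) else 0)"
    unfolding Rtilde_poly_def coeff_sum
    using lt by (intro sum.cong refl) (force simp: mult_2)
  then have "coeff Rtilde_poly (2 ^ (2 * d)) \<noteq> 0"
    using lead by simp
  then have "degree Rtilde_poly \<ge> 2 ^ (2 * d)"
    by (rule le_degree)
  moreover have "degree Rtilde_poly \<le> 2 ^ (2 * d)"
    unfolding Rtilde_poly_def
    by (intro degree_sum_le degree_add_le) (auto intro!: degree_monom_le[THEN order_trans] power_increasing)
  ultimately have "degree Rtilde_poly = 4 ^ d"
    by (simp add: power_mult)
  then show ?thesis
    using card_roots_if_pderiv_const[OF pd lead] by (simp add: W_eq_roots)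
qed

lemma finite_W: "finite W"
  using card_W card.infinite by fastforce

lemma S_square:
  assumes "n \<ge> 1" "S n \<noteq> 0"
  shows "S n ^ 2 = 2 ^ (m * n) * int (card (W \<inter> gf2 (m * n)))"
proof -
  interpret quad_form "gf2 (m * n)" "q n"
    using assms(1) by (rule quad_form_q)
  have "card (gf2 (m * n) :: 'a set) = 2 ^ (m * n)"
    using m_pos assms(1) by (intro card_gf2) simp
  then show ?thesis
    using gauss_sum_square assms radical_eq[OF assms(1) polarisation_q] unfolding S_def
    by (auto split: if_splits)
qed

lemma card_W_inter: "n \<ge> 1 \<Longrightarrow> \<exists>c. card (W \<inter> gf2 (m * n)) = 2 ^ c"
  using f2_group.card_eq_power_dim[OF quad_form.f2_group_radical[OF quad_form_q]]
  by (auto simp: radical_eq polarisation_q)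

text \<open>
  Here \<open>q n\<close> may be nonzero on the radical, so \<open>S n\<close> may vanish. But the Gauss sums of \<open>q n\<close> plus all
  linear forms \<open>Tr (c x)\<close> add up to the size of the field. Hence one of them is nonzero, and its square,
  which is \<open>2 ^ (m * n) * 4 ^ d\<close>, is the square of an integer.
\<close>
lemma even_if_W_subset:
  assumes n: "n \<ge> 1" and W: "W \<subseteq> gf2 (m * n)"
  shows "even (m * n)"
proof -
  let ?K = "gf2 (m * n) :: 'a set" and ?T = "abs_trace (m * n) :: 'a \<Rightarrow> bit"
  interpret K: f2_group ?K
    using n by (rule f2_group_field)
  interpret q: quad_form ?K "q n"
    using n by (rule quad_form_q)
  let ?q = "\<lambda>c x. q n x + ?T (c * x)"
  have cardK: "card ?K = 2 ^ (m * n)"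
    using m_pos n by (intro card_gf2) simp
  have "(\<Sum>c\<in>?K. gauss_sum ?K (?q c)) = (\<Sum>x\<in>?K. bit_sign (q n x) * (\<Sum>c\<in>?K. bit_sign (?T (c * x))))"
    unfolding gauss_sum_def bit_sign_add by (subst sum.swap) (simp add: sum_distrib_left)
  also have "\<dots> = (\<Sum>x\<in>?K. if x = 0 then int (card ?K) else 0)"
  proof (intro sum.cong refl)
    fix x assume x: "x \<in> ?K"
    have "(\<Sum>c\<in>?K. bit_sign (?T (c * x))) = (if \<forall>c\<in>?K. ?T (c * x) = 0 then int (card ?K) else 0)"
      by (rule K.sum_bit_sign_additive) (simp add: distrib_right abs_trace_add gf2_mult x)
    moreover have "(\<forall>c\<in>?K. ?T (c * x) = 0) \<longleftrightarrow> x = 0"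
      using ex_abs_trace_mult[of "m * n" x] x n m_pos by fastforce
    ultimately show "bit_sign (q n x) * (\<Sum>c\<in>?K. bit_sign (?T (c * x))) = (if x = 0 then int (card ?K) else 0)"
      by simp
  qed
  also have "\<dots> = int (card ?K)"
    using K.fin by simp
  finally have "(\<Sum>c\<in>?K. gauss_sum ?K (?q c)) \<noteq> 0"
    by (simp add: cardK)
  then obtain c where c: "c \<in> ?K" "gauss_sum ?K (?q c) \<noteq> 0"
    by (meson sum.neutral)
  have pol: "polarisation (?q c) x y = ?T (B x y)" if "x \<in> ?K" "y \<in> ?K" for x y
  proof -
    have "polarisation (?q c) x y = polarisation (q n) x y + (?T (c * x) + ?T (c * x)) + (?T (c * y) + ?T (c * y))"
      using that c by (simp only: polarisation_def distrib_left abs_trace_add gf2_mult ac_simps)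
    then show ?thesis
      using that by (simp add: polarisation_q)
  qed
  interpret qc: quad_form ?K "?q c"
    using n pol by (rule quad_form_if_polarisation)
  have "gauss_sum ?K (?q c) ^ 2 = int (card ?K * card (qf_radical ?K (?q c)))"
    using qc.gauss_sum_square c(2) by (auto split: if_splits)
  also have "\<dots> = 2 ^ (m * n) * 4 ^ d"
    using radical_eq[OF n pol] W by (simp add: cardK card_W Int_absorb2)
  also have "\<dots> = 2 ^ (m * n + 2 * d)"
    by (simp add: power_add power_mult)
  finally have sq: "gauss_sum ?K (?q c) ^ 2 = 2 ^ (m * n + 2 * d)" .
  have "multiplicity 2 (gauss_sum ?K (?q c) ^ 2) = 2 * multiplicity 2 (gauss_sum ?K (?q c))"
    using c(2) by (intro prime_elem_multiplicity_power_distrib) auto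
  then have "m * n + 2 * d = 2 * multiplicity 2 (gauss_sum ?K (?q c))"
    unfolding sq by simp
  then show ?thesis
    by presburger
qed

end

section \<open>Comparison of the sums modulo an odd prime\<close>

text \<open>
  If every orbit of \<open>g\<close> has length \<open>1\<close> or \<open>p\<close>, the long orbits contribute multiples of \<open>p\<close>. The proof
  removes one long orbit at a time.
\<close>
lemma sum_modulo_prime_action:
  fixes h :: "'x \<Rightarrow> int"
  assumes "finite A" "p > 0"
    and "\<And>x. x \<in> A \<Longrightarrow> g x \<in> A"
    and "\<And>x. x \<in> A \<Longrightarrow> (g ^^ p) x = x"
    and "\<And>x e. x \<in> A \<Longrightarrow> 0 < e \<Longrightarrow> e < p \<Longrightarrow> (g ^^ e) x = x \<Longrightarrow> g x = x"
    and "\<And>x. x \<in> A \<Longrightarrow> h (g x) = h x"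
  shows "int p dvd (\<Sum>x\<in>A. h x) - (\<Sum>x\<in>{x \<in> A. g x = x}. h x)"
  using assms
proof (induction A rule: finite_psubset_induct)
  case (psubset A)
  show ?case
  proof (cases "\<forall>x\<in>A. g x = x")
    case True
    then have "{x \<in> A. g x = x} = A"
      by blast
    then show ?thesis
      by simp
  next
    case False
    then obtain x where x: "x \<in> A" "g x \<noteq> x"
      by blast
    have mem: "(g ^^ i) x \<in> A" for i
      by (induction i) (simp_all add: x psubset.prems(2))
    have hx: "h ((g ^^ i) x) = h x" for i
      by (induction i) (simp_all add: psubset.prems(5) mem)
    have moved: "g ((g ^^ i) x) \<noteq> (g ^^ i) x" if "i < p" for i
    proof
      assume fixed: "g ((g ^^ i) x) = (g ^^ i) x"
      have "(g ^^ k) ((g ^^ i) x) = (g ^^ i) x" for k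
        by (induction k) (simp_all add: fixed)
      from this[of "p - i"] have "(g ^^ i) x = (g ^^ (p - i + i)) x"
        by (simp add: funpow_add)
      also have "\<dots> = x"
        using that psubset.prems(3)[OF x(1)] by simp
      finally show False
        using fixed x(2) by simp
    qed
    let ?O = "(\<lambda>i. (g ^^ i) x) ` {..<p}"
    \<comment> \<open>The orbit really has \<open>p\<close> elements.\<close>
    have neq: "(g ^^ i) x \<noteq> (g ^^ j) x" if "i < j" "j < p" for i j
    proof
      assume "(g ^^ i) x = (g ^^ j) x"
      also have "(g ^^ j) x = (g ^^ (j - i)) ((g ^^ i) x)"
        using that by (simp flip: funpow_add comp_apply[of "g ^^ (j - i)" "g ^^ i"])
      finally have "g ((g ^^ i) x) = (g ^^ i) x"
        using that mem by (intro psubset.prems(4)[of _ "j - i"]) auto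
      then show False
        using moved that by simp
    qed
    have inj: "inj_on (\<lambda>i. (g ^^ i) x) {..<p}"
    proof (rule inj_onI)
      fix i j assume "i \<in> {..<p}" "j \<in> {..<p}" "(g ^^ i) x = (g ^^ j) x"
      then show "i = j"
        using neq[of i j] neq[of j i] by (cases i j rule: linorder_cases) auto
    qed
    have sub: "?O \<subseteq> A"
      using mem by blast
    have sumO: "(\<Sum>y\<in>?O. h y) = int p * h x"
      using inj by (simp add: sum.reindex hx)
    have "int p dvd (\<Sum>y\<in>A - ?O. h y) - (\<Sum>y\<in>{y \<in> A - ?O. g y = y}. h y)"
    proof (rule psubset.IH)
      have "x \<in> ?O"
        using psubset.prems(1) by (intro image_eqI[of _ _ 0]) auto
      then show "A - ?O \<subset> A"
        using x(1) by blast
      fix y assume y: "y \<in> A - ?O"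
      have "g y \<notin> ?O"
      proof
        assume "g y \<in> ?O"
        then obtain i where i: "g y = (g ^^ i) x"
          by blast
        have "y = (g ^^ (p - 1)) (g y)"
          using psubset.prems(1) psubset.prems(3)[of y] y
          by (cases p) (simp_all add: funpow_swap1)
        also have "\<dots> = (g ^^ (p - 1 + i)) x"
          by (simp add: i funpow_add)
        also have "\<dots> = (g ^^ ((p - 1 + i) mod p)) x"
          using funpow_mod_eq[OF psubset.prems(3)[OF x(1)]] by simp
        finally have "y \<in> ?O"
          using psubset.prems(1) by auto
        with y show False
          by blast
      qed
      then show "g y \<in> A - ?O"
        using y psubset.prems(2) by blast
    qed (use psubset.prems in auto)
    moreover have "{y \<in> A - ?O. g y = y} = {y \<in> A. g y = y}"
      using moved by auto
    moreover have "(\<Sum>y\<in>A. h y) = (\<Sum>y\<in>A - ?O. h y) + int p * h x"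
      unfolding sumO[symmetric] by (rule sum.subset_diff[OF sub psubset.hyps])
    ultimately show ?thesis
      by (simp only: diff_add_eq[symmetric]) simp
  qed
qed

context trace_form begin

text \<open>
  The Frobenius map of the smaller field acts on the larger one. Its fixed points are the elements of the
  smaller field, and there the two forms agree, because the trace from the larger to the smaller field
  is multiplication by \<open>p\<close>, which is \<open>1\<close> in characteristic 2.
\<close>
lemma S_cong_prime_multiple:
  assumes n: "n \<ge> 1" and p: "prime p" "odd p"
  shows "int p dvd S (n * p) - S n"
proof -
  let ?A = "gf2 (m * (n * p)) :: 'a set" and ?g = "\<lambda>x::'a. x ^ (2 ^ (m * n))"
  have p0: "p > 0"
    using p(1) prime_gt_0_nat by blast
  have pow: "(?g ^^ i) x = x ^ (2 ^ (m * n * i))" for i x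
    by (induction i) (simp_all add: frob_frob add.commute)
  have fixed: "{x \<in> ?A. ?g x = x} = gf2 (m * n)"
    using gf2_mono[of "m * n" "m * (n * p)"] by (auto simp: gf2_def)
  have dvd: "int p dvd (\<Sum>x\<in>?A. bit_sign (q (n * p) x)) - (\<Sum>x\<in>{x \<in> ?A. ?g x = x}. bit_sign (q (n * p) x))"
  proof (rule sum_modulo_prime_action)
    show "finite ?A"
      using f2_group.fin[OF f2_group_field] n p0 by simp
    fix x assume x: "x \<in> ?A"
    show "?g x \<in> ?A"
      using x by (rule gf2_power)
    show "(?g ^^ p) x = x"
      using x by (simp add: pow gf2_def mult.assoc)
    show "bit_sign (q (n * p) (?g x)) = bit_sign (q (n * p) x)"
      using x by (simp add: q_def F_frob abs_trace_frob F_mem)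
    fix e assume e: "0 < e" "e < p" "(?g ^^ e) x = x"
    have "coprime e p"
      using e p(1) by (metis coprime_commute nat_dvd_not_less prime_imp_coprime)
    moreover have "x \<in> gf2 (m * n * e)"
      using e by (simp add: pow gf2_def)
    moreover have "x \<in> gf2 (m * n * p)"
      using x by (simp add: mult.assoc)
    ultimately have "x \<in> gf2 (m * n)"
      using gf2_inter_gcd[of x "m * n * e" "m * n * p"]
      by (simp add: gcd_mult_distrib_nat[symmetric] coprime_iff_gcd_eq_1)
    then show "?g x = x"
      by (simp add: gf2_def)
  qed (rule p0)
  have "(\<Sum>x\<in>gf2 (m * n). bit_sign (q (n * p) x)) = S n"
    unfolding S_def gauss_sum_def
  proof (intro sum.cong refl arg_cong[of _ _ bit_sign])
    fix x :: 'a assume x: "x \<in> gf2 (m * n)"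
    have "tr (m * n * p) (F x) = (\<Sum>i<p. tr (m * n) (F x))"
      unfolding tr_tower using gf2_frob_mult[OF F_mem[OF x]] by simp
    also have "\<dots> = of_nat p * tr (m * n) (F x)"
      by simp
    also have "(of_nat p :: 'a) = 1"
      using p(2) by (elim oddE) simp
    finally show "q (n * p) x = q n x"
      by (simp add: q_def abs_trace_eq mult.assoc)
  qed
  with dvd show ?thesis
    unfolding fixed by (simp add: S_def gauss_sum_def)
qed

text \<open>
  The square of a nonzero \<open>S n\<close> is a power of \<open>2\<close>.
\<close>
lemma prime_not_dvd_S:
  assumes "n \<ge> 1" "S n \<noteq> 0" "prime p" "odd p"
  shows "\<not> int p dvd S n"
proof
  assume "int p dvd S n"
  then have "int p dvd S n ^ 2"
    by (simp add: power2_eq_square)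
  moreover obtain c where "card (W \<inter> gf2 (m * n)) = 2 ^ c"
    using card_W_inter[OF assms(1)] by blast
  then have "S n ^ 2 = 2 ^ (m * n + c)"
    using S_square[OF assms(1,2)] by (simp add: power_add)
  ultimately have "int p dvd 2"
    using prime_dvd_power[of "int p" 2] assms(3) by simp
  then have "p dvd 2"
    by (metis int_dvd_int_iff of_nat_numeral)
  then show False
    using assms(3,4) primes_dvd_imp_eq two_is_prime_nat by blast
qed

text \<open>
  The absolute values of the two sums differ by a factor \<open>u\<close> that is \<open>1\<close> modulo \<open>p\<close> by Fermat's theorem;
  evenness of \<open>n\<close> is what makes \<open>u\<close> a \<open>(p - 1)\<close>-st power. With opposite signs, the congruence of the sums
  would give \<open>p dvd 2 * S n\<close>.
\<close>
lemma sgn_S_prime_multiple: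
  assumes n: "n \<ge> 1" "even n" and p: "prime p" "odd p"
    and W: "W \<inter> gf2 (m * (n * p)) = W \<inter> gf2 (m * n)"
  shows "sgn (S (n * p)) = sgn (S n)"
proof -
  have np: "n * p \<ge> 1"
    using n(1) prime_gt_0_nat[OF p(1)] by simp
  note dvd = S_cong_prime_multiple[OF n(1) p]
  show ?thesis
  proof (cases "S n = 0 \<or> S (n * p) = 0")
    case True
    then have "S n = 0 \<and> S (n * p) = 0"
      using dvd prime_not_dvd_S[OF n(1) _ p] prime_not_dvd_S[OF np _ p]
      by (metis diff_0_right dvd_minus_iff minus_diff_eq)
    then show ?thesis
      by simp
  next
    case False
    obtain h where h: "n = 2 * h"
      using n(2) by (elim evenE)
    define u :: int where "u = (2 ^ (m * h)) ^ (p - 1)"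
    have exp: "m * (n * p) = 2 * (m * h * (p - 1)) + m * n"
      using prime_gt_0_nat[OF p(1)] by (cases p) (simp_all add: h algebra_simps)
    have "S (n * p) ^ 2 = 2 ^ (m * (n * p)) * int (card (W \<inter> gf2 (m * n)))"
      using False S_square[OF np] by (simp only: W) simp
    also have "(2 :: int) ^ (m * (n * p)) = u ^ 2 * 2 ^ (m * n)"
      unfolding exp power_add u_def by (simp add: power_mult[symmetric] ac_simps)
    finally have "S (n * p) ^ 2 = u ^ 2 * S n ^ 2"
      using False S_square[OF n(1)] by simp
    then have "S (n * p) = u * S n \<or> S (n * p) = - (u * S n)"
      by (simp add: power_mult_distrib[symmetric] power2_eq_iff)
    moreover have "S (n * p) \<noteq> - (u * S n)"
    proof
      assume eq: "S (n * p) = - (u * S n)"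
      have "\<not> p dvd 2 ^ (m * h)"
        using p prime_dvd_power[of p 2] primes_dvd_imp_eq two_is_prime_nat by blast
      then have "[(2 ^ (m * h)) ^ (p - 1) = 1] (mod p)"
        using p(1) by (rule fermat_theorem[rotated])
      then have "[u = 1] (mod int p)"
        unfolding u_def by (simp flip: cong_int_iff)
      then have "int p dvd u - 1"
        by (simp add: cong_iff_dvd_diff)
      then have "int p dvd (S (n * p) - S n) + (u - 1) * S n"
        using dvd by simp
      also have "\<dots> = - (2 * S n)"
        by (simp add: eq algebra_simps)
      finally have "int p dvd 2 \<or> int p dvd S n"
        using p(1) by (simp add: prime_dvd_mult_iff)
      then show False
        using prime_not_dvd_S[OF n(1) _ p] False p
        by (metis int_dvd_int_iff of_nat_numeral primes_dvd_imp_eq two_is_prime_nat)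
    qed
    moreover have "u > 0"
      by (simp add: u_def)
    ultimately show ?thesis
      by (auto simp: sgn_mult)
  qed
qed

lemma sgn_S_odd_multiple:
  assumes "n \<ge> 1" "even n" "odd k" "W \<inter> gf2 (m * (n * k)) = W \<inter> gf2 (m * n)"
  shows "sgn (S (n * k)) = sgn (S n)"
  using assms(3,4)
proof (induction k rule: less_induct)
  case (less k)
  show ?case
  proof (cases "k = 1")
    case False
    then obtain p where p: "prime p" "p dvd k"
      using prime_factor_nat by blast
    then obtain l where l: "k = l * p"
      by (metis dvd_def mult.commute)
    have odd: "odd l" "odd p"
      using less.prems(1) l by auto
    have "l > 0"
      using odd(1) by (cases l) auto
    have sub: "gf2 (m * n) \<subseteq> (gf2 (m * (n * l)) :: 'a set)"
        "gf2 (m * (n * l)) \<subseteq> (gf2 (m * (n * k)) :: 'a set)"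
      unfolding l by (intro gf2_mono; simp)+
    have "l < k"
      using l \<open>l > 0\<close> prime_gt_1_nat[OF p(1)] by simp
    moreover have W_l: "W \<inter> gf2 (m * (n * l)) = W \<inter> gf2 (m * n)"
      using less.prems(2) sub by (intro equalityI) blast+
    ultimately have "sgn (S (n * l)) = sgn (S n)"
      by (intro less.IH odd)
    moreover have "W \<inter> gf2 (m * (n * l * p)) = W \<inter> gf2 (m * (n * l))"
      using less.prems(2) W_l by (simp add: l mult.assoc)
    then have "sgn (S (n * l * p)) = sgn (S (n * l))"
      using assms(1,2) \<open>l > 0\<close> odd p(1) by (intro sgn_S_prime_multiple) auto
    ultimately show ?thesis
      by (simp add: l mult.assoc)
  qed simp
qed

end

section \<open>Power sums of roots\<close>

text \<open>
  Newton's identities: \<open>1 - x X\<close> satisfies the equation with the geometric series \<open>x X + (x X)\<^sup>2 + \<dots>\<close>,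
  and logarithmic derivatives add up over products.
\<close>
lemma newton_fps:
  fixes A :: "'b::field multiset"
  shows "fps_X * fps_deriv (\<Prod>x\<in>#A. 1 - fps_const x * fps_X) =
    - ((\<Prod>x\<in>#A. 1 - fps_const x * fps_X) * Abs_fps (\<lambda>k. if k = 0 then 0 else \<Sum>x\<in>#A. x ^ k))"
proof (induction A)
  case empty
  have "Abs_fps (\<lambda>k. if k = 0 then 0 else \<Sum>x\<in>#{#}. x ^ k) = (0 :: 'b fps)"
    by (simp add: fps_eq_iff)
  then show ?case
    by simp
next
  case (add x A)
  let ?Q = "\<Prod>x\<in>#A. 1 - fps_const x * fps_X" and ?l = "1 - fps_const x * fps_X"
  let ?P = "\<lambda>A::'b multiset. Abs_fps (\<lambda>k. if k = 0 then 0 else \<Sum>x\<in>#A. x ^ k)"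
  have P: "?P (add_mset x A) = ?P {#x#} + ?P A"
    by (simp add: fps_eq_iff)
  have geo: "?l * ?P {#x#} = fps_const x * fps_X"
  proof (rule fps_ext)
    fix k
    show "fps_nth (?l * ?P {#x#}) k = fps_nth (fps_const x * fps_X) k"
      by (cases k) (auto simp: left_diff_distrib mult.assoc)
  qed
  have "fps_X * fps_deriv (?l * ?Q) = ?l * (fps_X * fps_deriv ?Q) - fps_const x * fps_X * ?Q"
    by (simp add: algebra_simps)
  also have "\<dots> = - (?l * ?Q * ?P A) - ?l * ?P {#x#} * ?Q"
    unfolding add.IH geo by (simp add: mult.assoc)
  also have "\<dots> = - (?l * ?Q * ?P (add_mset x A))"
    unfolding P by (simp add: algebra_simps)
  finally show ?case
    by simp
qed

definition root_poly :: "'b::field multiset \<Rightarrow> 'b poly" where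
  "root_poly A = (\<Prod>x\<in>#A. [:-x, 1:])"

lemma root_poly_empty [simp]: "root_poly {#} = 1"
  by (simp add: root_poly_def)

lemma root_poly_add: "root_poly (add_mset x A) = [:-x, 1:] * root_poly A"
  by (simp add: root_poly_def)

lemma root_poly_nonzero [simp]: "root_poly A \<noteq> 0"
  unfolding root_poly_def by (rule prod_linear_nonzero)

lemma proots_root_poly [simp]: "proots (root_poly A) = A"
  unfolding root_poly_def by (rule proots_prod_linear)

lemma degree_root_poly [simp]: "degree (root_poly A) = size A"
  by (induction A) (simp_all add: root_poly_add degree_mult_eq del: mult_pCons_left)

lemma lead_coeff_root_poly [simp]: "coeff (root_poly A) (size A) = 1"
proof -
  have "lead_coeff (root_poly A) = 1"
    by (induction A) (simp_all add: root_poly_add lead_coeff_mult del: mult_pCons_left)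
  then show ?thesis
    by simp
qed

lemma fps_reflect_root_poly:
  "fps_of_poly (reflect_poly (root_poly A)) = (\<Prod>x\<in>#A. 1 - fps_const x * fps_X)"
proof (induction A)
  case (add x A)
  have "reflect_poly [:-x, 1:] = [:1, -x:]"
    by (simp add: reflect_poly_def)
  then have "fps_of_poly (reflect_poly [:-x, 1:]) = 1 - fps_const x * fps_X"
    by (simp add: fps_of_poly_pCons)
  with add show ?case
    by (simp add: root_poly_add reflect_poly_mult fps_of_poly_mult del: mult_pCons_left)
qed simp

lemma root_poly_proots:
  fixes p :: "'b::alg_closed_field poly"
  assumes "lead_coeff p = 1"
  shows "root_poly (proots p) = p"
proof -
  have "p \<noteq> 0"
    using assms by auto
  then obtain A where "p = smult (lead_coeff p) (root_poly A)"
    using alg_closed_imp_factorization unfolding root_poly_def by blast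
  then have "p = root_poly A"
    using assms by simp
  then show ?thesis
    by simp
qed

context char2_field begin

text \<open>
  Newton's identities express the power sums of exponent at most \<open>s\<close> by the first \<open>s\<close> coefficients below
  the leading one. If only the \<open>s\<close>-th of these changes, then only the power sum of exponent \<open>s\<close> does, by
  \<open>s * c\<close> up to sign, which is \<open>c\<close> for odd \<open>s\<close> in characteristic 2.
\<close>
lemma power_sum_change_coefficient:
  fixes A A' :: "'a multiset"
  assumes s: "odd s" "s \<le> size A"
    and A': "root_poly A' = root_poly A + monom c (size A - s)"
    and j: "1 \<le> j" "j \<le> s"
  shows "(\<Sum>x\<in>#A'. x ^ j) = (\<Sum>x\<in>#A. x ^ j) + (if j = s then c else 0)"
proof -
  \<comment> \<open>Reversed polynomials have constant coefficient 1, hence are invertible as power series.\<close>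
  let ?Q = "\<lambda>A::'a multiset. fps_of_poly (reflect_poly (root_poly A))"
  let ?P = "\<lambda>A::'a multiset. Abs_fps (\<lambda>k. if k = 0 then 0 else \<Sum>x\<in>#A. x ^ k)"
  have neg: "- g = g" for g :: "'a fps"
    by (simp add: fps_eq_iff)
  have newton: "fps_X * fps_deriv (?Q A) = ?Q A * ?P A" for A
    using newton_fps[of A] by (simp add: fps_reflect_root_poly neg)
  have s0: "s \<noteq> 0"
    using s(1) by (cases s) auto
  have size: "size A' = size A"
  proof -
    have "degree (root_poly A + monom c (size A - s)) = size A"
    proof (rule antisym)
      show "degree (root_poly A + monom c (size A - s)) \<le> size A"
        by (intro degree_add_le) (auto intro: order_trans[OF degree_monom_le])
      show "size A \<le> degree (root_poly A + monom c (size A - s))"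
        using s0 s(2) by (intro le_degree) auto
    qed
    then show ?thesis
      using A' by (metis degree_root_poly)
  qed
  have Q': "?Q A' = ?Q A + fps_const c * fps_X ^ s"
  proof (rule fps_ext)
    fix k
    have "coeff (reflect_poly (root_poly A')) k = (if k > size A then 0 else coeff (root_poly A') (size A - k))"
      by (simp add: coeff_reflect_poly size)
    moreover have "size A - s = size A - k \<longleftrightarrow> k = s" if "k \<le> size A"
      using that s(2) by auto
    ultimately show "fps_nth (?Q A') k = fps_nth (?Q A + fps_const c * fps_X ^ s) k"
      using s(2) unfolding A' by (auto simp: coeff_reflect_poly fps_X_power_iff)
  qed
  have "fps_X * fps_deriv (fps_const c * fps_X ^ s) = fps_const c * fps_X ^ s"
  proof -
    have "(of_nat s :: 'a) = 1"
      using s(1) by (elim oddE) simp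
    then show ?thesis
      using s0 by (intro fps_ext) (auto simp: fps_X_power_iff)
  qed
  moreover have "fps_X * fps_deriv (?Q A') = fps_X * fps_deriv (?Q A) + fps_X * fps_deriv (fps_const c * fps_X ^ s)"
    unfolding Q' fps_deriv_add distrib_left ..
  ultimately have "?Q A * ?P A + fps_const c * fps_X ^ s = ?Q A' * ?P A'"
    by (simp only: newton)
  then have "?Q A * ?P A = ?Q A' * ?P A' - fps_const c * fps_X ^ s"
    by (simp only: eq_diff_eq)
  then have "?Q A * ?P A = ?Q A * ?P A' + fps_const c * fps_X ^ s * ?P A' + fps_const c * fps_X ^ s"
    by (simp only: Q' distrib_right diff_conv_add_uminus neg)
  moreover have "g * (u + v) = (g * v + g * v) + b * (1 + v)" if "g * u = g * v + b * v + b"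
    for b g u v :: "'a fps"
    using that by (simp add: algebra_simps)
  ultimately have "?Q A * (?P A + ?P A') = (?Q A * ?P A' + ?Q A * ?P A') + fps_const c * fps_X ^ s * (1 + ?P A')"
    by blast
  also have "?Q A * ?P A' + ?Q A * ?P A' = 0"
    by (intro fps_ext) (simp only: fps_add_nth add_self fps_zero_nth)
  finally have "?Q A * (?P A + ?P A') = fps_X ^ s * (fps_const c * (1 + ?P A'))"
    by (simp only: add_0_left mult.assoc mult.left_commute)
  then have "inverse (?Q A) * (?Q A * (?P A + ?P A')) = inverse (?Q A) * (fps_X ^ s * (fps_const c * (1 + ?P A')))"
    by simp
  moreover have Q0: "fps_nth (?Q A) 0 = 1"
    by (simp add: coeff_reflect_poly)
  then have "inverse (?Q A) * ?Q A = 1"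
    by (intro inverse_mult_eq_1) simp
  ultimately have "?P A + ?P A' = fps_X ^ s * (fps_const c * (1 + ?P A') * inverse (?Q A))"
    by (simp only: mult.assoc[symmetric] mult_1_left) (simp only: ac_simps)
  then have "fps_nth (?P A + ?P A') j = fps_nth (fps_X ^ s * (fps_const c * (1 + ?P A') * inverse (?Q A))) j"
    by simp
  also have "\<dots> = (if j = s then c else 0)"
    using j Q0 by (simp add: fps_X_power_mult_nth)
  finally have "(\<Sum>x\<in>#A. x ^ j) + (\<Sum>x\<in>#A'. x ^ j) = (if j = s then c else 0)"
    using j by simp
  then show ?thesis
    by (metis add_self_left)
qed

lemma sum_mset_frob: "(\<Sum>x\<in>#A. g x :: 'a) ^ (2 ^ k) = (\<Sum>x\<in>#A. g x ^ (2 ^ k))"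
  by (induction A) (simp_all add: frob_add power_0_left)

lemma coeff_root_poly_frob:
  fixes A :: "'a multiset"
  shows "coeff (root_poly (image_mset (\<lambda>x. x ^ (2 ^ k)) A)) i = coeff (root_poly A) i ^ (2 ^ k)"
proof (induction A arbitrary: i)
  case empty
  then show ?case
    by (cases i) (simp_all add: power_0_left)
next
  case (add x A)
  then show ?case
    by (cases i) (simp_all add: root_poly_add frob_add power_mult_distrib minus_eq)
qed

lemma frob_stable_iff_coeffs:
  fixes A :: "'a multiset"
  shows "image_mset (\<lambda>x. x ^ (2 ^ k)) A = A \<longleftrightarrow> (\<forall>i. coeff (root_poly A) i \<in> gf2 k)"
proof
  assume "\<forall>i. coeff (root_poly A) i \<in> gf2 k"
  then have "root_poly (image_mset (\<lambda>x. x ^ (2 ^ k)) A) = root_poly A"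
    by (intro poly_eqI) (simp add: coeff_root_poly_frob gf2_def)
  then show "image_mset (\<lambda>x. x ^ (2 ^ k)) A = A"
    by (metis proots_root_poly)
next
  assume "image_mset (\<lambda>x. x ^ (2 ^ k)) A = A"
  then show "\<forall>i. coeff (root_poly A) i \<in> gf2 k"
    using coeff_root_poly_frob[of k A] by (simp add: gf2_def)
qed

end

section \<open>The L-function\<close>

context trace_form begin

text \<open>
  Effective divisors of the affine line over the base field are rendered as the multisets in the ambient
  field that are stable under Frobenius, and \<open>cyc k x\<close> is the divisor of an element \<open>x\<close> of the extension of
  degree \<open>k\<close>: a multiple of its orbit. The map \<open>chi\<close> is multiplicative on divisors, and \<open>L_coeff r\<close> is
  the coefficient of \<open>T ^ r\<close> in its \<open>L\<close>-function.
\<close>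
definition cyc :: "nat \<Rightarrow> 'a \<Rightarrow> 'a multiset" where
  "cyc k x = image_mset (\<lambda>i. x ^ (2 ^ (m * i))) (mset_set {..<k})"

definition frob_stable :: "nat \<Rightarrow> 'a multiset set" where
  "frob_stable r = {A. size A = r \<and> image_mset (\<lambda>x. x ^ (2 ^ m)) A = A}"

definition chi :: "'a multiset \<Rightarrow> int" where
  "chi A = bit_sign (abs_trace m (\<Sum>x\<in>#A. F x))"

definition L_coeff :: "nat \<Rightarrow> int" where
  "L_coeff r = (\<Sum>A\<in>frob_stable r. chi A)"

lemma finite_gf2: "k \<ge> 1 \<Longrightarrow> finite (gf2 k :: 'a set)"
  using f2_group.fin[OF f2_group_gf2] .

text \<open>
  A stable multiset is determined by the coefficients of the monic polynomial with these roots, which lie in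
  the finite base field.
\<close>
lemma finite_stable: "finite (frob_stable r)"
proof (rule inj_on_finite)
  show "inj_on (\<lambda>A. restrict (coeff (root_poly A)) {..r}) (frob_stable r)"
  proof (rule inj_onI)
    fix A A' assume A: "A \<in> frob_stable r" "A' \<in> frob_stable r"
      and eq: "restrict (coeff (root_poly A)) {..r} = restrict (coeff (root_poly A')) {..r}"
    have "coeff (root_poly A) i = coeff (root_poly A') i" for i
    proof (cases "i \<le> r")
      case True
      then show ?thesis
        using fun_cong[OF eq, of i] by simp
    next
      case False
      then show ?thesis
        using A by (simp add: frob_stable_def coeff_eq_0)
    qed
    then show "A = A'"
      by (metis poly_eqI proots_root_poly)
  qed
  show "(\<lambda>A. restrict (coeff (root_poly A)) {..r}) ` frob_stable r \<subseteq> Pi\<^sub>E {..r} (\<lambda>_. gf2 m)"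
    by (intro image_subsetI) (simp add: restrict_PiE_iff frob_stable_def frob_stable_iff_coeffs)
  show "finite (Pi\<^sub>E {..r} (\<lambda>_. gf2 m :: 'a set))"
    using finite_gf2[OF m_pos] by (intro finite_PiE) auto
qed

lemma sum_F_stable:
  assumes "A \<in> frob_stable r"
  shows "(\<Sum>x\<in>#A. F x) \<in> gf2 m"
proof -
  have "(\<Sum>x\<in>#A. F x) ^ (2 ^ m) = (\<Sum>x\<in>#image_mset (\<lambda>x. x ^ (2 ^ m)) A. F x)"
    using F_frob[of _ 1] by (simp add: sum_mset_frob image_mset.compositionality comp_def)
  then show ?thesis
    using assms by (simp add: gf2_def frob_stable_def)
qed

lemma size_cyc [simp]: "size (cyc k x) = k"
  by (simp add: cyc_def)

text \<open>
  Frobenius shifts the exponents \<open>0, \<dots>, k - 1\<close> to \<open>1, \<dots>, k\<close>, and the exponents \<open>0\<close> and \<open>k\<close> give the same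
  element.
\<close>
lemma cyc_stable:
  assumes "x \<in> gf2 (m * k)"
  shows "cyc k x \<in> frob_stable k"
proof -
  have "{..<Suc k} = insert 0 (Suc ` {..<k})"
    by (rule lessThan_Suc_eq_insert_0)
  then have "add_mset 0 (image_mset Suc (mset_set {..<k})) = mset_set (insert k {..<k})"
    by (subst image_mset_mset_set) (auto simp: lessThan_Suc[symmetric])
  then have "add_mset 0 (image_mset Suc (mset_set {..<k})) = add_mset k (mset_set {..<k})"
    by simp
  then have "image_mset (\<lambda>i. x ^ (2 ^ (m * i))) (add_mset 0 (image_mset Suc (mset_set {..<k})))
      = image_mset (\<lambda>i. x ^ (2 ^ (m * i))) (add_mset k (mset_set {..<k}))"
    by simp
  then have "image_mset (\<lambda>i. x ^ (2 ^ (m * Suc i))) (mset_set {..<k}) = cyc k x"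
    using assms by (simp add: cyc_def gf2_def image_mset.compositionality comp_def)
  then show ?thesis
    by (simp add: frob_stable_def cyc_def image_mset.compositionality comp_def frob_frob add.commute)
qed

text \<open>
  The conjugates of \<open>F x\<close> over the base field add up to its relative trace, so transitivity of the trace
  identifies the value of \<open>chi\<close> on \<open>cyc k x\<close>.
\<close>
lemma chi_cyc_add:
  assumes x: "x \<in> gf2 (m * k)" and A: "A \<in> frob_stable r"
  shows "chi (cyc k x + A) = bit_sign (q k x) * chi A"
proof -
  have sum: "(\<Sum>y\<in>#cyc k x. F y) = (\<Sum>i<k. F x ^ (2 ^ (m * i)))"
    by (simp add: cyc_def image_mset.compositionality comp_def F_frob sum_unfold_sum_mset)
  have "abs_trace m (\<Sum>y\<in>#cyc k x. F y) = q k x"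
    unfolding sum by (simp add: abs_trace_eq q_def tr_tower tr_sum)
  then show ?thesis
    using sum_F_stable[OF cyc_stable[OF x]] sum_F_stable[OF A]
    by (simp add: chi_def abs_trace_add bit_sign_add)
qed

lemma stable_diff:
  assumes "A \<in> frob_stable r" "C \<in> frob_stable k" "C \<subseteq># A"
  shows "A - C \<in> frob_stable (r - k)"
  using assms by (auto simp: frob_stable_def size_Diff_submset image_mset_Diff)

lemma stable_add: "A \<in> frob_stable r \<Longrightarrow> C \<in> frob_stable k \<Longrightarrow> C + A \<in> frob_stable (k + r)"
  by (auto simp: frob_stable_def)

lemma sum_chi_containing_cyc:
  assumes "x \<in> gf2 (m * k)" "k \<le> r"
  shows "(\<Sum>A\<in>{A \<in> frob_stable r. cyc k x \<subseteq># A}. chi A) = bit_sign (q k x) * L_coeff (r - k)"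
proof -
  have "(\<Sum>A\<in>{A \<in> frob_stable r. cyc k x \<subseteq># A}. chi A) = (\<Sum>A\<in>frob_stable (r - k). chi (cyc k x + A))"
    using stable_add[OF _ cyc_stable[OF assms(1)], of _ "r - k"] stable_diff[OF _ cyc_stable[OF assms(1)]] assms(2)
    by (intro sum.reindex_bij_witness[of _ "\<lambda>A. cyc k x + A" "\<lambda>A. A - cyc k x"]) auto
  also have "\<dots> = bit_sign (q k x) * L_coeff (r - k)"
    unfolding L_coeff_def sum_distrib_left
    by (intro sum.cong refl chi_cyc_add[OF assms(1)])
  finally show ?thesis .
qed

lemma cyc_Suc: "cyc (Suc k) x = add_mset (x ^ (2 ^ (m * k))) (cyc k x)"
  by (simp add: cyc_def lessThan_Suc)

lemma cyc_add: "cyc (k + l) x = cyc k x + cyc l (x ^ (2 ^ (m * k)))"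
  by (induction l) (simp_all add: cyc_Suc frob_frob distrib_left cyc_def[of 0])

lemma stable_count:
  assumes "A \<in> frob_stable r"
  shows "count A (x ^ (2 ^ (m * i))) = count A x"
proof (induction i)
  case (Suc i)
  have "count (image_mset (\<lambda>x. x ^ (2 ^ m)) A) (y ^ (2 ^ m)) = count A y" for y
    by (induction A) (auto simp: frob_inject)
  then have "count A (y ^ (2 ^ m)) = count A y" for y
    using assms by (simp add: frob_stable_def)
  from this[of "x ^ (2 ^ (m * i))"] Suc show ?case
    by (simp add: frob_frob add.commute)
qed simp

text \<open>
  Let \<open>per\<close> be the length of the Frobenius orbit of \<open>x\<close>. The admissible \<open>k\<close> are the multiples \<open>per * t\<close>, for
  which \<open>cyc k x\<close> is \<open>t\<close> times the orbit. Since all points of the orbit have the same multiplicity in \<open>A\<close>, it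
  fits into \<open>A\<close> exactly for \<open>t \<le> count A x\<close>.
\<close>
lemma card_cyc_subset_multiset:
  assumes A: "A \<in> frob_stable r" and x: "x \<in># A"
  shows "card {k \<in> {1..r}. x \<in> gf2 (m * k) \<and> cyc k x \<subseteq># A} = count A x"
proof -
  have fixed: "x \<in> gf2 (m * (j - i))" if "x ^ (2 ^ (m * i)) = x ^ (2 ^ (m * j))" "i < j" for i j
  proof -
    have "(x ^ (2 ^ (m * (j - i)))) ^ (2 ^ (m * i)) = x ^ (2 ^ (m * i))"
      using that by (simp add: frob_frob distrib_left[symmetric])
    then show ?thesis
      unfolding frob_inject by (simp add: gf2_def)
  qed
  have "range (\<lambda>i. x ^ (2 ^ (m * i))) \<subseteq> set_mset A"
    using stable_count[OF A, of x] x by (auto simp: count_greater_zero_iff[symmetric] simp del: count_greater_zero_iff)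
  then have "\<not> inj (\<lambda>i. x ^ (2 ^ (m * i)))"
    using finite_subset finite_imageD by blast
  then obtain i' j' where "x ^ (2 ^ (m * i')) = x ^ (2 ^ (m * j'))" "i' \<noteq> j'"
    unfolding inj_def by blast
  then obtain i j where ij: "x ^ (2 ^ (m * i)) = x ^ (2 ^ (m * j))" "i < j"
    using that[of i' j'] that[of j' i'] by (cases i' j' rule: linorder_cases) auto
  define per where "per = (LEAST k. k \<ge> 1 \<and> x \<in> gf2 (m * k))"
  have "j - i \<ge> 1 \<and> x \<in> gf2 (m * (j - i))"
    using ij fixed by simp
  then have per: "per \<ge> 1" "x \<in> gf2 (m * per)"
    using LeastI[of "\<lambda>k. k \<ge> 1 \<and> x \<in> gf2 (m * k)"] unfolding per_def by blast+
  have per_le: "per \<le> k" if "k \<ge> 1" "x \<in> gf2 (m * k)" for k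
    using that unfolding per_def by (intro Least_le) simp
  have per_dvd: "per dvd k" if "k \<ge> 1" "x \<in> gf2 (m * k)" for k
  proof -
    have "x \<in> gf2 (m * gcd k per)"
      using gf2_inter_gcd[OF that(2) per(2)] by (simp add: gcd_mult_distrib_nat)
    then have "per \<le> gcd k per"
      using that by (intro per_le) (auto simp: Suc_le_eq)
    then have "gcd k per = per"
      using per(1) gcd_le2_nat[of per k] by linarith
    then show ?thesis
      by (metis gcd_dvd1)
  qed
  define orb where "orb = (\<lambda>i. x ^ (2 ^ (m * i))) ` {..<per}"
  have neq: "x ^ (2 ^ (m * i)) \<noteq> x ^ (2 ^ (m * j))" if "i < j" "j < per" for i j
  proof
    assume "x ^ (2 ^ (m * i)) = x ^ (2 ^ (m * j))"
    then have "x \<in> gf2 (m * (j - i))"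
      using that(1) by (rule fixed)
    then have "per \<le> j - i"
      using that(1) by (intro per_le) auto
    with that show False
      by linarith
  qed
  have "inj_on (\<lambda>i. x ^ (2 ^ (m * i))) {..<per}"
  proof (rule inj_onI)
    fix i j assume "i \<in> {..<per}" "j \<in> {..<per}" "x ^ (2 ^ (m * i)) = x ^ (2 ^ (m * j))"
    then show "i = j"
      using neq[of i j] neq[of j i] by (cases i j rule: linorder_cases) auto
  qed
  then have cyc_per: "cyc per x = mset_set orb"
    unfolding cyc_def orb_def by (rule image_mset_mset_set)
  have fin: "finite orb"
    by (simp add: orb_def)
  have x_orb: "x \<in> orb"
    using per(1) unfolding orb_def by (intro image_eqI[of _ _ 0]) auto
  have "cyc (per * t) x = repeat_mset t (cyc per x)" for t
  proof (induction t)
    case (Suc t)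
    have "cyc (per + per * t) x = cyc per x + cyc (per * t) x"
      unfolding cyc_add using per(2) by (simp add: gf2_def)
    with Suc show ?case
      by simp
  qed (simp add: cyc_def)
  then have count_cyc: "count (cyc (per * t) x) y = (if y \<in> orb then t else 0)" for t y
    using fin by (simp add: cyc_per count_mset_set')
  have subset_iff: "cyc (per * t) x \<subseteq># A \<longleftrightarrow> t \<le> count A x" for t
  proof
    assume "cyc (per * t) x \<subseteq># A"
    then have "count (cyc (per * t) x) x \<le> count A x"
      by (simp add: subseteq_mset_def)
    then show "t \<le> count A x"
      using x_orb by (simp add: count_cyc)
  next
    assume "t \<le> count A x"
    moreover have "count A y = count A x" if "y \<in> orb" for y
      using that stable_count[OF A] by (auto simp: orb_def)
    ultimately show "cyc (per * t) x \<subseteq># A"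
      by (simp add: subseteq_mset_def count_cyc)
  qed
  have "{k \<in> {1..r}. x \<in> gf2 (m * k) \<and> cyc k x \<subseteq># A} = (\<lambda>t. per * t) ` {1..count A x}"
  proof (intro equalityI subsetI)
    fix k assume k: "k \<in> {k \<in> {1..r}. x \<in> gf2 (m * k) \<and> cyc k x \<subseteq># A}"
    then obtain t where "k = per * t"
      using per_dvd[of k] by auto
    with k show "k \<in> (\<lambda>t. per * t) ` {1..count A x}"
      using subset_iff by (intro image_eqI[of _ _ t]) auto
  next
    fix k assume "k \<in> (\<lambda>t. per * t) ` {1..count A x}"
    then obtain t where "k = per * t" "t \<in> {1..count A x}"
      by blast
    then have t: "k = per * t" "t \<ge> 1" "t \<le> count A x"
      by auto
    have "cyc k x \<subseteq># A"
      using t subset_iff by simp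
    moreover from this have "k \<le> r"
      using size_mset_mono A by (fastforce simp: frob_stable_def)
    moreover have "x \<in> gf2 (m * k)"
      using gf2_mono[of "m * per" "m * k"] per(2) t(1) by auto
    ultimately show "k \<in> {k \<in> {1..r}. x \<in> gf2 (m * k) \<and> cyc k x \<subseteq># A}"
      using per(1) t by simp
  qed
  moreover have "inj_on (\<lambda>t. per * t) {1..count A x}"
    using per(1) by (auto simp: inj_on_def)
  ultimately show ?thesis
    by (simp add: card_image)
qed

lemma sum_card_cyc_subset:
  assumes A: "A \<in> frob_stable r"
  shows "(\<Sum>k=1..r. card {x \<in> gf2 (m * k). cyc k x \<subseteq># A}) = r"
proof -
  have mem: "x \<in># A" if "cyc k x \<subseteq># A" "k \<ge> 1" for x k
  proof -
    have "x ^ (2 ^ (m * 0)) \<in># cyc k x"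
      unfolding cyc_def using that(2) by (intro image_eqI[of _ _ 0, THEN in_image_mset[THEN iffD2]]) auto
    then show ?thesis
      using that(1) by (auto dest: mset_subset_eqD)
  qed
  have "(\<Sum>k=1..r. card {x \<in> gf2 (m * k). cyc k x \<subseteq># A})
      = (\<Sum>k=1..r. \<Sum>x\<in>set_mset A. if x \<in> gf2 (m * k) \<and> cyc k x \<subseteq># A then 1 else 0)"
  proof (intro sum.cong refl)
    fix k assume "k \<in> {1..r}"
    then have "{x \<in> gf2 (m * k). cyc k x \<subseteq># A} = {x \<in> set_mset A. x \<in> gf2 (m * k) \<and> cyc k x \<subseteq># A}"
      using mem by auto
    then show "card {x \<in> gf2 (m * k). cyc k x \<subseteq># A}
        = (\<Sum>x\<in>set_mset A. if x \<in> gf2 (m * k) \<and> cyc k x \<subseteq># A then 1 else 0)"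
      by (simp add: sum.If_cases Int_def)
  qed
  also have "\<dots> = (\<Sum>x\<in>set_mset A. card {k \<in> {1..r}. x \<in> gf2 (m * k) \<and> cyc k x \<subseteq># A})"
    by (subst sum.swap) (simp add: sum.If_cases Int_def)
  also have "\<dots> = (\<Sum>x\<in>set_mset A. count A x)"
    using card_cyc_subset_multiset[OF A] by simp
  also have "\<dots> = r"
    using A by (simp add: frob_stable_def size_multiset_overloaded_eq)
  finally show ?thesis .
qed

text \<open>
  This is the logarithmic derivative of the \<open>L\<close>-function. It results from counting \<open>chi A\<close> once for every way
  to remove some \<open>cyc k x\<close> from \<open>A\<close>: there are \<open>r\<close> such ways for each \<open>A\<close> of size \<open>r\<close>.
\<close>
lemma L_coeff_recursion: "int r * L_coeff r = (\<Sum>k=1..r. S k * L_coeff (r - k))"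
proof -
  have fin: "finite (gf2 (m * k) :: 'a set)" if "k \<in> {1..r}" for k
    using that m_pos by (intro finite_gf2) auto
  have "int r * L_coeff r = (\<Sum>A\<in>frob_stable r. \<Sum>k=1..r. chi A * int (card {x \<in> gf2 (m * k). cyc k x \<subseteq># A}))"
    unfolding L_coeff_def sum_distrib_left
  proof (intro sum.cong refl)
    fix A assume "A \<in> frob_stable r"
    then have "int r * chi A = chi A * int (\<Sum>k=1..r. card {x \<in> gf2 (m * k). cyc k x \<subseteq># A})"
      by (simp only: sum_card_cyc_subset) (simp add: mult.commute)
    also have "\<dots> = (\<Sum>k=1..r. chi A * int (card {x \<in> gf2 (m * k). cyc k x \<subseteq># A}))"
      by (simp only: of_nat_sum sum_distrib_left)
    finally show "int r * chi A = (\<Sum>k=1..r. chi A * int (card {x \<in> gf2 (m * k). cyc k x \<subseteq># A}))" .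
  qed
  also have "\<dots> = (\<Sum>k=1..r. \<Sum>A\<in>frob_stable r. \<Sum>x\<in>gf2 (m * k). if cyc k x \<subseteq># A then chi A else 0)"
    using fin by (subst sum.swap) (intro sum.cong refl, simp add: sum.If_cases Int_def mult.commute)
  also have "\<dots> = (\<Sum>k=1..r. \<Sum>x\<in>gf2 (m * k). \<Sum>A\<in>{A \<in> frob_stable r. cyc k x \<subseteq># A}. chi A)"
    using finite_stable by (intro sum.cong refl, subst sum.swap) (simp add: sum.inter_filter)
  also have "\<dots> = (\<Sum>k=1..r. \<Sum>x\<in>gf2 (m * k). bit_sign (q k x) * L_coeff (r - k))"
    by (intro sum.cong refl sum_chi_containing_cyc) auto
  also have "\<dots> = (\<Sum>k=1..r. S k * L_coeff (r - k))"
    by (simp add: S_def gauss_sum_def sum_distrib_right)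
  finally show ?thesis .
qed

lemma L_coeff_0: "L_coeff 0 = 1"
proof -
  have "frob_stable 0 = {{#}}"
    by (auto simp: frob_stable_def)
  then show ?thesis
    by (simp add: L_coeff_def chi_def)
qed

lemma sum_F_eq_power_sums: "(\<Sum>x\<in>#A. F x) = (\<Sum>i\<le>d. a i * (\<Sum>x\<in>#A. x ^ (2 ^ i + 1)))"
  by (induction A) (simp_all add: F_def distrib_left sum.distrib)

text \<open>
  The \<open>L\<close>-function is a polynomial: adding \<open>c X ^ (r - s)\<close> with \<open>s = 2 ^ d + 1\<close> to the monic polynomial of a
  divisor is an involution on the divisors of degree \<open>r\<close>. Of the power sums that enter \<open>chi\<close> it changes only
  the one of exponent \<open>s\<close>, which has coefficient \<open>a d\<close>. Choosing \<open>c\<close> with \<open>Tr (c * a d) = 1\<close> reverses all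
  signs.
\<close>
lemma L_coeff_eq_0:
  assumes r: "r > 2 ^ d"
  shows "L_coeff r = 0"
proof -
  define s where "s = (2::nat) ^ d + 1"
  have s: "odd s" "s \<le> r" "s \<ge> 1"
    using r d_pos by (auto simp: s_def)
  obtain c where c: "c \<in> gf2 m" "abs_trace m (c * a d) = 1"
    using ex_abs_trace_mult[OF m_pos coeff_mem[OF order_refl] lead] by blast
  define \<tau> where "\<tau> A = proots (root_poly A + monom c (r - s))" for A
  have \<tau>: "root_poly (\<tau> A) = root_poly A + monom c (r - s)" "\<tau> A \<in> frob_stable r" if A: "A \<in> frob_stable r" for A
  proof -
    let ?p = "root_poly A + monom c (r - s)"
    have size: "size A = r"
      using A by (simp add: frob_stable_def)
    have deg: "degree ?p = r"
    proof (rule antisym)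
      show "degree ?p \<le> r"
        by (intro degree_add_le) (auto simp: size intro: order_trans[OF degree_monom_le])
      show "r \<le> degree ?p"
        using s lead_coeff_root_poly[of A] by (intro le_degree) (auto simp: size)
    qed
    moreover have "coeff ?p r = 1"
      using s lead_coeff_root_poly[of A] by (auto simp: size)
    ultimately show eq: "root_poly (\<tau> A) = ?p"
      unfolding \<tau>_def by (intro root_poly_proots) simp
    have "size (\<tau> A) = r"
      using deg eq by (metis degree_root_poly)
    moreover have "image_mset (\<lambda>x. x ^ (2 ^ m)) (\<tau> A) = \<tau> A"
      using A c(1) unfolding frob_stable_iff_coeffs eq frob_stable_def by (auto intro: gf2_add)
    ultimately show "\<tau> A \<in> frob_stable r"
      by (simp add: frob_stable_def)
  qed
  have invol: "\<tau> (\<tau> A) = A" if "A \<in> frob_stable r" for A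
  proof -
    have "monom c (r - s) + monom c (r - s) = (0 :: 'a poly)"
      by (simp add: add_monom)
    then have "root_poly (\<tau> A) + monom c (r - s) = root_poly A"
      using \<tau>(1)[OF that] by (simp add: add.assoc)
    then show ?thesis
      by (simp add: \<tau>_def[of "\<tau> A"])
  qed
  have chi: "chi (\<tau> A) = - chi A" if A: "A \<in> frob_stable r" for A
  proof -
    have size: "size A = r"
      using A by (simp add: frob_stable_def)
    have "(\<Sum>x\<in>#\<tau> A. F x) = (\<Sum>i\<le>d. a i * ((\<Sum>x\<in>#A. x ^ (2 ^ i + 1)) + (if i = d then c else 0)))"
      unfolding sum_F_eq_power_sums
    proof (intro sum.cong refl arg_cong[of _ _ "(*) _"])
      fix i assume "i \<in> {..d}"
      then have "2 ^ i + 1 \<le> s" "2 ^ i + 1 = s \<longleftrightarrow> i = d"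
        by (auto simp: s_def intro: power_increasing)
      then show "(\<Sum>x\<in>#\<tau> A. x ^ (2 ^ i + 1)) = (\<Sum>x\<in>#A. x ^ (2 ^ i + 1)) + (if i = d then c else 0)"
        using power_sum_change_coefficient[of s A "\<tau> A" c "2 ^ i + 1"] s \<tau>(1)[OF A] by (simp add: size)
    qed
    also have "\<dots> = (\<Sum>x\<in>#A. F x) + (\<Sum>i\<le>d. if i = d then a i * c else 0)"
      unfolding sum_F_eq_power_sums sum.distrib[symmetric]
      by (intro sum.cong refl) (simp add: distrib_left)
    also have "(\<Sum>i\<le>d. if i = d then a i * c else 0) = c * a d"
      by simp
    finally show ?thesis
      using c sum_F_stable[OF A] coeff_mem[of d]
      by (simp add: chi_def abs_trace_add gf2_mult bit_sign_add)
  qed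
  have "L_coeff r = (\<Sum>A\<in>frob_stable r. chi (\<tau> A))"
    unfolding L_coeff_def
    by (rule sum.reindex_bij_witness[of _ \<tau> \<tau>]) (auto simp: \<tau> invol)
  also have "\<dots> = - L_coeff r"
    by (simp add: L_coeff_def chi sum_negf)
  finally show ?thesis
    by simp
qed

end

section \<open>The reciprocal roots of the L-function\<close>

lemma indexed_sum_of_sum_mset:
  assumes "size A = D"
  obtains z :: "nat \<Rightarrow> 'b::comm_monoid_add" where "\<And>g :: 'b \<Rightarrow> 'c::comm_monoid_add. (\<Sum>x\<in>#A. g x) = (\<Sum>i<D. g (z i))"
proof -
  obtain xs where xs: "A = mset xs"
    using ex_mset[of A] by blast
  then have "length xs = D"
    using assms by simp
  then have "(\<Sum>x\<in>#A. g x) = (\<Sum>i<D. g (xs ! i))" for g :: "'b \<Rightarrow> 'c"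
    by (simp add: xs sum_mset_sum_list sum_list_sum_nth atLeast0LessThan flip: mset_map)
  then show ?thesis
    using that by blast
qed

text \<open>
  The series with coefficients \<open>c r\<close> is a polynomial, so it factors into factors \<open>1 - z i X\<close>. Both \<open>s\<close> and the
  negative power sums of the \<open>z i\<close> are the coefficients of its logarithmic derivative.
\<close>
lemma roots_of_logarithmic_recursion:
  fixes c s :: "nat \<Rightarrow> complex"
  assumes c0: "c 0 = 1" and cD: "\<And>r. r > D \<Longrightarrow> c r = 0"
    and rec: "\<And>r. of_nat r * c r = (\<Sum>k=1..r. s k * c (r - k))"
  obtains z :: "nat \<Rightarrow> complex" where "\<And>k. k \<ge> 1 \<Longrightarrow> s k = - (\<Sum>i<D. z i ^ k)"
proof -
  define p where "p = (\<Sum>r\<le>D. monom (c r) (D - r))"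
  have coeff: "coeff p (D - r) = c r" if "r \<le> D" for r
  proof -
    have "coeff p (D - r) = (\<Sum>j\<le>D. if j = r then c j else 0)"
      unfolding p_def coeff_sum using that by (intro sum.cong refl) auto
    then show ?thesis
      using that by simp
  qed
  have deg: "degree p = D"
  proof (rule antisym)
    show "degree p \<le> D"
      unfolding p_def by (intro degree_sum_le) (auto intro: order_trans[OF degree_monom_le])
    show "D \<le> degree p"
      using coeff[of 0] c0 by (intro le_degree) simp
  qed
  define A where "A = proots p"
  have root_poly: "root_poly A = p"
    unfolding A_def using coeff[of 0] c0 deg by (intro root_poly_proots) simp
  have size: "size A = D"
    using deg root_poly by (metis degree_root_poly)
  let ?L = "fps_of_poly (reflect_poly p)" and ?S = "Abs_fps (\<lambda>k. if k = 0 then 0 else s k)"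
  let ?P = "Abs_fps (\<lambda>k. if k = 0 then 0 else \<Sum>x\<in>#A. x ^ k)"
  have L: "coeff (reflect_poly p) r = c r" for r
    using coeff[of r] cD[of r] by (simp add: coeff_reflect_poly deg)
  have "fps_X * fps_deriv ?L = - (?L * ?P)"
    using newton_fps[of A] fps_reflect_root_poly[of A] by (simp add: root_poly)
  moreover have "fps_X * fps_deriv ?L = ?L * ?S"
  proof (rule fps_ext)
    fix r
    have "fps_nth (fps_X * fps_deriv ?L) r = of_nat r * c r"
      by (cases r) (simp_all add: L)
    also have "\<dots> = (\<Sum>k=0..r. fps_nth ?S k * c (r - k))"
      unfolding rec by (simp add: sum.atLeast_Suc_atMost)
    also have "\<dots> = fps_nth (?S * ?L) r"
      unfolding fps_mult_nth fps_of_poly_nth L ..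
    finally show "fps_nth (fps_X * fps_deriv ?L) r = fps_nth (?L * ?S) r"
      by (simp add: mult.commute)
  qed
  ultimately have "?L * ?S = ?L * (- ?P)"
    by simp
  moreover have "?L \<noteq> 0"
    using L[of 0] c0 by auto
  ultimately have eq: "?S = - ?P"
    by (rule mult_left_cancel[THEN iffD1, rotated])
  have s_eq: "s k = - (\<Sum>x\<in>#A. x ^ k)" if "k \<ge> 1" for k
    using arg_cong[OF eq, of "\<lambda>g. fps_nth g k"] that by simp
  obtain z :: "nat \<Rightarrow> complex" where z: "\<And>g :: complex \<Rightarrow> complex. (\<Sum>x\<in>#A. g x) = (\<Sum>i<D. g (z i))"
    using indexed_sum_of_sum_mset[OF size] by blast
  show ?thesis
    by (rule that[of z]) (simp only: s_eq z)
qed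

text \<open>
  Suppose that the largest absolute value \<open>M\<close>, attained at \<open>z l\<close>, exceeds \<open>\<rho>\<close>. The generating function of the power sums,
  \<open>\<Sum>i. z i T / (1 - z i T)\<close>, has a pole at \<open>T = 1 / z l\<close>, whereas the bound makes the power series converge
  beyond this point. On the ray \<open>T = t / z l\<close> both sides are compared for \<open>t\<close> tending to \<open>1\<close> from
  below, after multiplication by \<open>1 - t\<close>.
\<close>
lemma norm_le_if_power_sums_bounded:
  fixes z :: "nat \<Rightarrow> complex" and \<rho> C :: real
  assumes \<rho>: "\<rho> > 0" and bound: "\<And>k. k \<ge> 1 \<Longrightarrow> norm (\<Sum>i<D. z i ^ k) \<le> C * \<rho> ^ k"
    and j: "j < D"
  shows "norm (z j) \<le> \<rho>"
proof (rule ccontr)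
  assume "\<not> norm (z j) \<le> \<rho>"
  define M where "M = Max ((\<lambda>i. norm (z i)) ` {..<D})"
  have M_ge: "norm (z i) \<le> M" if "i < D" for i
    unfolding M_def using that by (intro Max_ge) auto
  have "M \<in> (\<lambda>i. norm (z i)) ` {..<D}"
    unfolding M_def using j by (intro Max_in) auto
  then obtain l where l: "l < D" "norm (z l) = M"
    by auto
  have M: "M > \<rho>"
    using M_ge[OF j] \<open>\<not> norm (z j) \<le> \<rho>\<close> by simp
  define w where "w i = z i / z l" for i
  have zl: "z l \<noteq> 0"
    using l(2) M \<rho> by auto
  have w: "norm (w i) \<le> 1" if "i < D" for i
    using M_ge[OF that] M \<rho> by (simp add: w_def norm_divide l)
  define h where "h t = (\<Sum>i<D. w i * of_real t / (1 - w i * of_real t))" for t :: real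
  define K where "K = \<bar>C\<bar> * (\<rho> / M) / (1 - \<rho> / M)"
  have h_bound: "norm (h t) \<le> K" if t: "0 < t" "t < 1" for t
  proof -
    have "(\<lambda>k. (w i * of_real t) ^ Suc k) sums (w i * of_real t / (1 - w i * of_real t))" if "i < D" for i
    proof -
      have "norm (w i * of_real t) < 1"
        using w[OF that] t by (simp add: norm_mult) (smt (verit) mult_left_le_one_le norm_ge_zero)
      from sums_mult[OF geometric_sums[OF this], of "w i * of_real t"] show ?thesis
        by simp
    qed
    then have sums: "(\<lambda>k. \<Sum>i<D. (w i * of_real t) ^ Suc k) sums h t"
      unfolding h_def by (intro sums_sum) simp
    have term_bound: "norm (\<Sum>i<D. (w i * of_real t) ^ Suc k) \<le> \<bar>C\<bar> * (\<rho> / M) * (\<rho> / M) ^ k" for k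
    proof -
      have "(\<Sum>i<D. (w i * of_real t) ^ Suc k) = (of_real t / z l) ^ Suc k * (\<Sum>i<D. z i ^ Suc k)"
        unfolding sum_distrib_left
        by (intro sum.cong refl) (simp add: w_def power_divide power_mult_distrib)
      also have "norm \<dots> = (t / M) ^ Suc k * norm (\<Sum>i<D. z i ^ Suc k)"
        using t by (simp add: norm_mult norm_power norm_divide l)
      also have "\<dots> \<le> (1 / M) ^ Suc k * (\<bar>C\<bar> * \<rho> ^ Suc k)"
      proof (intro mult_mono)
        show "(t / M) ^ Suc k \<le> (1 / M) ^ Suc k"
          using t M \<rho> by (intro power_mono divide_right_mono) auto
        have "norm (\<Sum>i<D. z i ^ Suc k) \<le> C * \<rho> ^ Suc k"
          by (rule bound) simp
        also have "\<dots> \<le> \<bar>C\<bar> * \<rho> ^ Suc k"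
          using \<rho> by (intro mult_right_mono) auto
        finally show "norm (\<Sum>i<D. z i ^ Suc k) \<le> \<bar>C\<bar> * \<rho> ^ Suc k" .
      qed (use M \<rho> in auto)
      also have "\<dots> = \<bar>C\<bar> * (\<rho> / M) * (\<rho> / M) ^ k"
        by (simp add: power_divide)
      finally show ?thesis .
    qed
    have quot: "norm (\<rho> / M) < 1"
      using M \<rho> by simp
    have geo: "(\<lambda>k. \<bar>C\<bar> * (\<rho> / M) * (\<rho> / M) ^ k) sums K"
      using sums_mult[OF geometric_sums[OF quot], of "\<bar>C\<bar> * (\<rho> / M)"] by (simp add: K_def)
    have "norm (\<Sum>k. \<Sum>i<D. (w i * of_real t) ^ Suc k) \<le> (\<Sum>k. \<bar>C\<bar> * (\<rho> / M) * (\<rho> / M) ^ k)"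
      by (rule norm_suminf_le) (use geo term_bound in \<open>auto simp: sums_iff\<close>)
    then show ?thesis
      using sums geo by (simp add: sums_iff)
  qed
  have "((\<lambda>t. of_real (1 - t) * h t) \<longlongrightarrow> of_nat (card {i. i < D \<and> w i = 1})) (at_left 1)"
  proof -
    have lim: "((\<lambda>t. of_real (1 - t) * (w i * of_real t / (1 - w i * of_real t))) \<longlongrightarrow> (if w i = 1 then 1 else 0)) (at_left (1::real))" for i
    proof (cases "w i = 1")
      case True
      have "((\<lambda>t. complex_of_real t) \<longlongrightarrow> of_real 1) (at_left 1)"
        by (intro tendsto_intros)
      moreover have "\<forall>\<^sub>F t in at_left (1::real). complex_of_real t = of_real (1 - t) * (w i * of_real t / (1 - w i * of_real t))"
        unfolding eventually_at_filter by (rule always_eventually) (auto simp: True)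
      ultimately show ?thesis
        using True by (auto intro: Lim_transform_eventually)
    next
      case False
      have "((\<lambda>t. of_real (1 - t) * (w i * of_real t / (1 - w i * of_real t))) \<longlongrightarrow> of_real (1 - 1) * (w i * of_real 1 / (1 - w i * of_real 1))) (at_left (1::real))"
        using False by (intro tendsto_intros) auto
      then show ?thesis
        using False by simp
    qed
    have "((\<lambda>t. \<Sum>i<D. of_real (1 - t) * (w i * of_real t / (1 - w i * of_real t))) \<longlongrightarrow> (\<Sum>i<D. if w i = 1 then 1 else 0)) (at_left 1)"
      by (intro tendsto_sum lim)
    moreover have "(\<Sum>i<D. if w i = 1 then 1 else 0 :: complex) = of_nat (card {i. i < D \<and> w i = 1})"
      by (simp add: sum.If_cases Int_def)
    ultimately show ?thesis
      by (simp add: h_def sum_distrib_left)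
  qed
  moreover have "((\<lambda>t. of_real (1 - t) * h t) \<longlongrightarrow> 0) (at_left 1)"
  proof (rule tendsto_0_le)
    show "((\<lambda>t. 1 - t) \<longlongrightarrow> 0) (at_left (1::real))"
      by (rule tendsto_eq_intros refl)+ simp
    have "\<forall>\<^sub>F t in at_left (1::real). 0 < t \<and> t < 1"
      using eventually_at_left_real[of 0 1] by (auto elim: eventually_mono)
    then show "\<forall>\<^sub>F t in at_left 1. norm (of_real (1 - t) * h t) \<le> norm (1 - t) * K"
    proof (rule eventually_mono)
      fix t :: real assume t: "0 < t \<and> t < 1"
      then show "norm (of_real (1 - t) * h t) \<le> norm (1 - t) * K"
        unfolding norm_mult norm_of_real real_norm_def using h_bound by (intro mult_left_mono) auto
    qed
  qed
  ultimately have "of_nat (card {i. i < D \<and> w i = 1}) = (0 :: complex)"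
    using tendsto_unique[OF trivial_limit_at_left_real] by blast
  moreover have "l \<in> {i. i < D \<and> w i = 1}"
    using l zl by (simp add: w_def)
  ultimately show False
    by (auto simp: card_eq_0_iff)
qed

text \<open>
  Equality in the triangle inequality.
\<close>
lemma eq_if_sum_extremal:
  fixes w :: "nat \<Rightarrow> complex"
  assumes "\<And>i. i < D \<Longrightarrow> norm (w i) \<le> B" and sum: "(\<Sum>i<D. w i) = of_real (of_nat D * B)"
    and i: "i < D"
  shows "w i = of_real B"
proof -
  have le: "Re (w i) \<le> B" if "i < D" for i
    using assms(1)[OF that] complex_Re_le_cmod order_trans by blast
  have "(\<Sum>i<D. B - Re (w i)) = 0"
    using arg_cong[OF sum, of Re] by (simp add: sum_subtractf)
  then have "Re (w i) = B"
    using le i by (subst (asm) sum_nonneg_eq_0_iff) auto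
  moreover from this have "Im (w i) = 0"
    using assms(1)[OF i] cmod_power2[of "w i"] norm_ge_zero[of "w i"]
    by (smt (verit) power_mono zero_eq_power2 zero_le_power2)
  ultimately show ?thesis
    by (simp add: complex_eq_iff)
qed

section \<open>The sign law\<close>

lemma sgn_of_int: "sgn (real_of_int i) = real_of_int (sgn i)"
  by (simp add: sgn_if)

context trace_form begin

text \<open>
  The radical has at most \<open>4 ^ d\<close> elements, and exactly that many if the field contains \<open>W\<close>.
\<close>
lemma S_bound:
  assumes "k \<ge> 1"
  shows "\<bar>real_of_int (S k)\<bar> \<le> 2 ^ d * sqrt (2 ^ m) ^ k"
    and "S k \<noteq> 0 \<Longrightarrow> W \<subseteq> gf2 (m * k) \<Longrightarrow> \<bar>real_of_int (S k)\<bar> = 2 ^ d * sqrt (2 ^ m) ^ k"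
proof -
  have "(sqrt (2 ^ m) ^ k) ^ 2 = (sqrt (2 ^ m) ^ 2) ^ k"
    by (simp only: power_mult[symmetric] mult.commute)
  moreover have "((2 :: real) ^ d) ^ 2 = (2 ^ 2) ^ d"
    by (simp only: power_mult[symmetric] mult.commute)
  ultimately have rhs: "(2 ^ d * sqrt (2 ^ m) ^ k) ^ 2 = real_of_int (2 ^ (m * k) * 4 ^ d)"
    by (simp add: power_mult_distrib power_mult)
  show "\<bar>real_of_int (S k)\<bar> \<le> 2 ^ d * sqrt (2 ^ m) ^ k"
  proof (cases "S k = 0")
    case False
    have "card (W \<inter> gf2 (m * k)) \<le> 4 ^ d"
      using card_mono[OF finite_W, of "W \<inter> gf2 (m * k)"] by (simp add: card_W)
    then have "int (card (W \<inter> gf2 (m * k))) \<le> int (4 ^ d)"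
      by (simp only: of_nat_le_iff)
    then have "S k ^ 2 \<le> 2 ^ (m * k) * 4 ^ d"
      unfolding S_square[OF assms False] by (intro mult_left_mono) auto
    then have "real_of_int (S k ^ 2) \<le> real_of_int (2 ^ (m * k) * 4 ^ d)"
      by (simp only: of_int_le_iff)
    then have "\<bar>real_of_int (S k)\<bar> ^ 2 \<le> (2 ^ d * sqrt (2 ^ m) ^ k) ^ 2"
      unfolding rhs by simp
    then show ?thesis
      by (rule power2_le_imp_le) simp
  qed simp
  assume S: "S k \<noteq> 0" and W: "W \<subseteq> gf2 (m * k)"
  have "S k ^ 2 = 2 ^ (m * k) * 4 ^ d"
    using S_square[OF assms S] W by (simp add: Int_absorb2 card_W)
  then have "real_of_int (S k ^ 2) = real_of_int (2 ^ (m * k) * 4 ^ d)"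
    by (simp only:)
  then have "\<bar>real_of_int (S k)\<bar> ^ 2 = (2 ^ d * sqrt (2 ^ m) ^ k) ^ 2"
    unfolding rhs by simp
  then show "\<bar>real_of_int (S k)\<bar> = 2 ^ d * sqrt (2 ^ m) ^ k"
    by (rule power2_eq_imp_eq) simp_all
qed

lemma obtain_roots:
  obtains z :: "nat \<Rightarrow> complex"
  where "\<And>k. k \<ge> 1 \<Longrightarrow> of_int (S k) = - (\<Sum>i<2 ^ d. z i ^ k)"
proof (rule roots_of_logarithmic_recursion[where c = "\<lambda>r. of_int (L_coeff r)" and s = "\<lambda>k. of_int (S k)"
      and D = "2 ^ d"])
  show "of_nat r * of_int (L_coeff r) = (\<Sum>k=1..r. of_int (S k) * of_int (L_coeff (r - k)) :: complex)" for r
    using arg_cong[OF L_coeff_recursion[of r], of "of_int :: int \<Rightarrow> complex"] by simp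
qed (use that in \<open>simp_all add: L_coeff_0 L_coeff_eq_0\<close>)

text \<open>
  The \<open>2 ^ d\<close> numbers \<open>z i ^ E\<close> have absolute value at most \<open>\<rho> ^ E\<close> and a sum of absolute value
  \<open>2 ^ d * \<rho> ^ E\<close>, so they all equal \<open>- \<sigma> * \<rho> ^ E\<close>, where \<open>\<sigma>\<close> is the sign of \<open>S E\<close>. Therefore shifting
  the exponent by \<open>E\<close> multiplies all power sums by this number.
\<close>
lemma sgn_S_add_period:
  assumes E: "E \<ge> 1" "W \<subseteq> gf2 (m * E)" "S E \<noteq> 0" and n: "n \<ge> 1"
  shows "sgn (S (n + E)) = - (sgn (S E) * sgn (S n))"
proof -
  obtain z :: "nat \<Rightarrow> complex" where z: "\<And>k. k \<ge> 1 \<Longrightarrow> of_int (S k) = - (\<Sum>i<2 ^ d. z i ^ k)"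
    using obtain_roots by blast
  define \<rho> where "\<rho> = sqrt (2 ^ m)"
  define \<sigma> where "\<sigma> = sgn (S E)"
  have \<rho>: "\<rho> > 0"
    by (simp add: \<rho>_def)
  have \<sigma>: "\<sigma> = 1 \<or> \<sigma> = - 1" "\<sigma> * S E = \<bar>S E\<bar>"
    using E(3) by (auto simp: \<sigma>_def sgn_if)
  have norm_z: "norm (z i) \<le> \<rho>" if "i < 2 ^ d" for i
  proof (rule norm_le_if_power_sums_bounded[OF \<rho> _ that])
    fix k :: nat assume "k \<ge> 1"
    then have "norm (\<Sum>i<2 ^ d. z i ^ k) = norm (complex_of_int (S k))"
      by (simp add: z)
    then show "norm (\<Sum>i<2 ^ d. z i ^ k) \<le> 2 ^ d * \<rho> ^ k"
      using S_bound(1)[OF \<open>k \<ge> 1\<close>] by (simp add: \<rho>_def)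
  qed
  have pow: "- of_int \<sigma> * z i ^ E = of_real (\<rho> ^ E)" if "i < 2 ^ d" for i
  proof (rule eq_if_sum_extremal[OF _ _ that])
    show "norm (- of_int \<sigma> * z i ^ E) \<le> \<rho> ^ E" if "i < 2 ^ d" for i
      using \<sigma>(1) norm_z[OF that] by (auto simp: norm_mult norm_power intro!: power_mono)
    have "(\<Sum>i<2 ^ d. - of_int \<sigma> * z i ^ E) = of_int \<sigma> * of_int (S E)"
      using E(1) by (simp add: z sum_distrib_left sum_negf)
    also have "\<dots> = complex_of_int (\<sigma> * S E)"
      by simp
    also have "\<dots> = of_real (real_of_int \<bar>S E\<bar>)"
      by (simp only: \<sigma>(2) of_real_of_int_eq)
    also have "real_of_int \<bar>S E\<bar> = of_nat (2 ^ d) * \<rho> ^ E"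
      using S_bound(2)[OF E(1) E(3,2)] by (simp add: \<rho>_def)
    finally show "(\<Sum>i<2 ^ d. - of_int \<sigma> * z i ^ E) = of_real (of_nat (2 ^ d) * \<rho> ^ E)" .
  qed
  have z_E: "z i ^ E = - of_int \<sigma> * of_real (\<rho> ^ E)" if "i < 2 ^ d" for i
  proof -
    have "z i ^ E = (- of_int \<sigma>) * (- of_int \<sigma> * z i ^ E)"
      using \<sigma>(1) by auto
    then show ?thesis
      unfolding pow[OF that] .
  qed
  have "complex_of_int (S (n + E)) = - (\<Sum>i<2 ^ d. z i ^ n * z i ^ E)"
    using n z[of "n + E"] by (simp add: power_add)
  also have "\<dots> = - (\<Sum>i<2 ^ d. z i ^ n * (- of_int \<sigma> * of_real (\<rho> ^ E)))"
    by (intro arg_cong[of _ _ uminus] sum.cong refl) (simp only: z_E lessThan_iff)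
  also have "\<dots> = (- of_int \<sigma> * of_real (\<rho> ^ E)) * of_int (S n)"
    unfolding z[OF n] sum_distrib_right[symmetric] by (simp add: mult.commute)
  also have "\<dots> = of_real (- (real_of_int \<sigma> * \<rho> ^ E * real_of_int (S n)))"
    by simp
  finally have "complex_of_real (real_of_int (S (n + E))) = of_real (- (real_of_int \<sigma> * \<rho> ^ E * real_of_int (S n)))"
    by (simp only: of_real_of_int_eq)
  then have "real_of_int (S (n + E)) = - (real_of_int \<sigma> * \<rho> ^ E * real_of_int (S n))"
    by (simp only: of_real_eq_iff)
  then have "sgn (real_of_int (S (n + E))) = - (sgn (real_of_int \<sigma>) * sgn (real_of_int (S n)))"
    using \<rho> by (simp add: sgn_mult sgn_minus)
  then have "real_of_int (sgn (S (n + E))) = real_of_int (- (sgn \<sigma> * sgn (S n)))"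
    by (simp add: sgn_of_int)
  then show ?thesis
    unfolding of_int_eq_iff by (simp add: \<sigma>_def)
qed

lemma odd_quotient_by_gcd:
  fixes n E :: nat
  assumes "n > 0" "E > 0" "multiplicity 2 n \<le> multiplicity 2 E"
  shows "odd (n div gcd n E)"
proof
  assume "even (n div gcd n E)"
  have "2 ^ multiplicity 2 n dvd gcd n E"
    using assms(3) by (simp add: multiplicity_dvd multiplicity_dvd')
  then have "2 ^ multiplicity 2 n * 2 dvd gcd n E * (n div gcd n E)"
    using \<open>even (n div gcd n E)\<close> by (rule mult_dvd_mono)
  then have "2 ^ Suc (multiplicity 2 n) dvd n"
    by (simp add: mult.commute)
  then have "Suc (multiplicity 2 n) \<le> multiplicity 2 n"
    using assms(1) by (intro multiplicity_geI) auto
  then show False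
    by simp
qed

text \<open>
  Since \<open>W\<close> lies in the field of degree \<open>E\<close>, passing from \<open>gcd n E\<close> to its multiple \<open>n\<close> adds nothing to the
  radical, and the quotient is odd.
\<close>
lemma sgn_S_gcd:
  assumes E: "E \<ge> 1" "even E" "W \<subseteq> gf2 (m * E)" and n: "n \<ge> 1" "even n"
    and v: "multiplicity 2 n \<le> multiplicity 2 E"
  shows "sgn (S n) = sgn (S (gcd n E))"
proof -
  let ?g = "gcd n E"
  have "W \<inter> gf2 (m * n) = W \<inter> gf2 (m * ?g)"
  proof (intro equalityI subsetI)
    fix x assume "x \<in> W \<inter> gf2 (m * n)"
    then show "x \<in> W \<inter> gf2 (m * ?g)"
      using gf2_inter_gcd[of x "m * n" "m * E"] E(3) by (auto simp: gcd_mult_distrib_nat)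
  next
    fix x assume "x \<in> W \<inter> gf2 (m * ?g)"
    then show "x \<in> W \<inter> gf2 (m * n)"
      using gf2_mono[of "m * ?g" "m * n"] by auto
  qed
  moreover have "odd (n div ?g)"
    using E n v by (intro odd_quotient_by_gcd) auto
  moreover have "?g \<ge> 1" "even ?g"
    using E n by (auto simp: Suc_le_eq)
  ultimately have "sgn (S (?g * (n div ?g))) = sgn (S ?g)"
    by (intro sgn_S_odd_multiple) auto
  then show ?thesis
    by simp
qed

text \<open>
  Replacing \<open>n\<close> by \<open>n + E\<close> multiplies the sign by \<open>- sgn (S E)\<close> and keeps the greatest common divisor with
  \<open>E\<close>. If the valuation of \<open>n\<close> is larger than that of \<open>E\<close>, the shift lowers it to that of \<open>E\<close>; if it is
  smaller, the shift keeps it.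
\<close>
lemma sign_law:
  assumes E: "E \<ge> 1" "even E" "W \<subseteq> gf2 (m * E)" and n: "n \<ge> 1" "even n"
  shows "sgn (S E) = - 1 \<Longrightarrow> sgn (S n) = sgn (S (gcd n E))"
    and "sgn (S E) = 1 \<Longrightarrow> multiplicity 2 n < multiplicity 2 E \<Longrightarrow> sgn (S n) = 0"
    and "sgn (S E) = 1 \<Longrightarrow> multiplicity 2 n > multiplicity 2 E \<Longrightarrow> sgn (S n) = - sgn (S (gcd n E))"
proof -
  note gcd_eq = sgn_S_gcd[OF E]
  have shift: "sgn (S (n + E)) = - (sgn (S E) * sgn (S n))" if "S E \<noteq> 0"
    using sgn_S_add_period[OF E(1,3) that n(1)] .
  have large: "sgn (S (n + E)) = sgn (S (gcd n E))" if "multiplicity 2 n > multiplicity 2 E"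
  proof -
    have "multiplicity 2 (E + n) = multiplicity 2 E"
      using that E n by (intro multiplicity_sum_lt) auto
    then show ?thesis
      using gcd_eq[of "n + E"] E n by (simp add: add.commute[of E])
  qed
  show "sgn (S n) = sgn (S (gcd n E))" if "sgn (S E) = - 1"
  proof (cases "multiplicity 2 n \<le> multiplicity 2 E")
    case False
    moreover have "S E \<noteq> 0"
      using that by auto
    ultimately show ?thesis
      using large shift that by simp
  qed (rule gcd_eq[OF n])
  assume pos: "sgn (S E) = 1"
  then have "S E \<noteq> 0"
    by auto
  then have shift': "sgn (S (n + E)) = - sgn (S n)"
    using shift pos by simp
  show "sgn (S n) = 0" if "multiplicity 2 n < multiplicity 2 E"
  proof -
    have "multiplicity 2 (n + E) = multiplicity 2 n"
      using that E n by (intro multiplicity_sum_lt) auto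
    then have "sgn (S (n + E)) = sgn (S (gcd n E))"
      using gcd_eq[of "n + E"] E n that by simp
    moreover have "sgn (S n) = sgn (S (gcd n E))"
      using that by (intro gcd_eq[OF n]) simp
    ultimately show ?thesis
      using shift' by simp
  qed
  show "sgn (S n) = - sgn (S (gcd n E))" if "multiplicity 2 n > multiplicity 2 E"
    using shift' large[OF that] by simp
qed

end

theorem proposition5p2:
  fixes m d N n :: nat
    and a :: "nat \<Rightarrow> 'a::alg_closed_field"
    and R f Rt :: "'a poly"
  assumes char2: "CHAR('a) = 2"
    and m: "m \<ge> 1" "odd m"
    and d: "d \<ge> 1"
    and a: "\<forall>i\<le>d. a i \<in> gf2 m" "a d \<noteq> 0"
    and R: "R = (\<Sum>i\<le>d. Polynomial.monom (a i) (2 ^ i))"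
    and f: "f = [:0, 1:] * R"
    and Rt: "Rt = (\<Sum>i\<le>d. Polynomial.monom (a i ^ (2 ^ d)) (2 ^ (d + i))
                        + Polynomial.monom (a i ^ (2 ^ (d - i))) (2 ^ (d - i)))"
    and N: "N \<ge> 1" "gf2 (m * N) = splitting_field (gf2 m) Rt"
    and n: "n \<ge> 2" "even n"
  shows
    "(eps_ext m f N = -1 \<longrightarrow> eps_ext m f n = eps_ext m f (gcd n N)) \<and>
     (eps_ext m f N = 1 \<longrightarrow>
        (1 \<le> multiplicity 2 n \<and> multiplicity 2 n \<le> multiplicity 2 N - 1 \<longrightarrow>
           eps_ext m f n = 0) \<and>
        (multiplicity 2 n = multiplicity 2 N \<longrightarrow>
           eps_ext m f n = eps_ext m f (gcd n N)) \<and>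
        (multiplicity 2 n \<ge> multiplicity 2 N + 1 \<longrightarrow>
           eps_ext m f n = - eps_ext m f (gcd n N))) \<and>
     (eps_ext m f N = 0 \<longrightarrow>
        (eps_ext m f (2 * N) = -1 \<longrightarrow> eps_ext m f n = eps_ext m f (gcd n (2 * N))) \<and>
        (eps_ext m f (2 * N) = 1 \<longrightarrow>
           (1 \<le> multiplicity 2 n \<and> multiplicity 2 n \<le> multiplicity 2 N \<longrightarrow>
              eps_ext m f n = 0) \<and>
           (multiplicity 2 n = multiplicity 2 N + 1 \<longrightarrow>
              eps_ext m f n = eps_ext m f (gcd n (2 * N))) \<and>
           (multiplicity 2 n \<ge> multiplicity 2 N + 2 \<longrightarrow>
              eps_ext m f n = - eps_ext m f (gcd n (2 * N)))))"

proof -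
  interpret trace_form "TYPE('a)" m d a
    using char2 m d a by unfold_locales auto
  have poly_f: "poly f x = F x" for x
    by (simp add: f R F_def poly_sum poly_monom sum_distrib_left ac_simps)
  have eps: "eps_ext m f k = sgn (S k)" if "k \<ge> 1" for k
  proof -
    have "(\<lambda>x. abs_trace (m * k) (F x)) = q k"
      by (simp add: q_def fun_eq_iff)
    then show ?thesis
      unfolding eps_ext_def poly_f S_def
      using qf_eps_eq_sgn_gauss_sum[OF quad_form_q[OF that]] by simp
  qed
  have "Rt = Rtilde_poly"
    by (simp add: Rt Rtilde_poly_def)
  then have WN: "W \<subseteq> gf2 (m * N)"
    unfolding N(2) splitting_field_def W_eq_roots by (auto intro: generate_field.incl)
  then have "even (m * N)"
    using N(1) by (intro even_if_W_subset)
  then have evenN: "even N"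
    using m(2) by simp
  have W2N: "W \<subseteq> gf2 (m * (2 * N))"
    using WN gf2_mono[of "m * N" "m * (2 * N)"] by auto
  have v2N: "multiplicity 2 (2 * N) = multiplicity 2 N + 1"
    using N(1) by (subst multiplicity_times_same) auto
  have n1: "n \<ge> 1" "gcd n N \<ge> 1" "gcd n (2 * N) \<ge> 1" "2 * N \<ge> 1" "even (2 * N)"
    using n N(1) by (auto simp: Suc_le_eq)
  note N_law = sign_law[OF N(1) evenN WN n1(1) n(2)] sgn_S_gcd[OF N(1) evenN WN n1(1) n(2)]
  note N2_law = sign_law[OF n1(4,5) W2N n1(1) n(2)] sgn_S_gcd[OF n1(4,5) W2N n1(1) n(2)]
  show ?thesis
    unfolding eps[OF n1(1)] eps[OF n1(2)] eps[OF n1(3)] eps[OF n1(4)] eps[OF N(1)]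
    using N_law N2_law by (auto simp: v2N)
qed

end
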